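(* Let $d\ge 3$ and $W(\mathbf{x})=-\frac{|\mathbf{x}|^b}{b}$ on $\mathbb{R}^d$ with $2-d<b<0$. Then there exists a smooth radial function $U:\mathbb{R}^d\to\mathbb{R}$ satisfying $\lim_{|\mathbf{x}|\to\infty}U(\mathbf{x})=0$, such that there exists a smooth and radial $\rho_\sharp\in\mathcal{M}(\mathbb{R}^d)$ supported on a ball $\overline{B(0;R)}$ with $\sup_{B(0;R)}V[\rho_\sharp]<0$, but $E_{W,U}$ does not admit a minimizer in $\mathcal{M}(\mathbb{R}^d)$.
   Context: $\mathcal{M}(\mathbb{R}^d)$ is the set of Borel probability measures on $\mathbb{R}^d$; $\rho_\sharp$ smooth and radial means it has a smooth radial density with respect to Lebesgue measure. $W(0)=+\infty$. $E_{W,U}[\rho]=\frac12\int\int W(\mathbf{x}-\mathbf{y})\,d\rho(\mathbf{y})\,d\rho(\mathbf{x})+\int U(\mathbf{x})\,d\rho(\mathbf{x})$ for $\rho\in\mathcal{M}(\mathbb{R}^d)$, with values in $\mathbb{R}\cup\{\infty\}$. $V[\rho]=W*\rho+U$, where $(W*\rho)(\mathbf{x})=\int W(\mathbf{x}-\mathbf{y})\,d\rho(\mathbf{y})$. *)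

theory Defs
  imports "HOL-Probability.Probability"
begin

definition borel_probs :: "('a::euclidean_space) measure set" where
  "borel_probs = {\<rho>. prob_space \<rho> \<and> sets \<rho> = sets borel}"

text \<open>Lebesgue integral with values in the extended reals: positive part minus negative part.
  When both parts are infinite it takes the junk value \<infinity> - \<infinity> = \<infinity> of type \<^typ>\<open>ereal\<close>.\<close>

definition ereal_integral :: "'a measure \<Rightarrow> ('a \<Rightarrow> ereal) \<Rightarrow> ereal" where
  "ereal_integral M f =
     enn2ereal (\<integral>\<^sup>+ x. e2ennreal (f x) \<partial>M) - enn2ereal (\<integral>\<^sup>+ x. e2ennreal (- f x) \<partial>M)"

definition power_potential :: "real \<Rightarrow> 'a::euclidean_space \<Rightarrow> ereal" where
  "power_potential b x = (if x = 0 then \<infinity> else ereal (- (norm x powr b) / b))"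

definition conv_measure :: "('a::euclidean_space \<Rightarrow> ereal) \<Rightarrow> 'a measure \<Rightarrow> 'a \<Rightarrow> ereal" where
  "conv_measure W \<rho> x = ereal_integral \<rho> (\<lambda>y. W (x - y))"

definition energy ::
  "('a::euclidean_space \<Rightarrow> ereal) \<Rightarrow> ('a \<Rightarrow> real) \<Rightarrow> 'a measure \<Rightarrow> ereal" where
  "energy W U \<rho> =
     ereal (1/2) * ereal_integral \<rho> (\<lambda>x. ereal_integral \<rho> (\<lambda>y. W (x - y)))
     + ereal_integral \<rho> (\<lambda>x. ereal (U x))"

definition generated_potential ::
  "('a::euclidean_space \<Rightarrow> ereal) \<Rightarrow> ('a \<Rightarrow> real) \<Rightarrow> 'a measure \<Rightarrow> 'a \<Rightarrow> ereal" where
  "generated_potential W U \<rho> x = conv_measure W \<rho> x + ereal (U x)"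

definition is_minimizer ::
  "('a::euclidean_space \<Rightarrow> ereal) \<Rightarrow> ('a \<Rightarrow> real) \<Rightarrow> 'a measure \<Rightarrow> bool" where
  "is_minimizer W U \<rho> \<longleftrightarrow>
     \<rho> \<in> borel_probs \<and> (\<forall>\<mu>\<in>borel_probs. energy W U \<rho> \<le> energy W U \<mu>)"

definition radial :: "('a::euclidean_space \<Rightarrow> real) \<Rightarrow> bool" where
  "radial f \<longleftrightarrow> (\<forall>x y. norm x = norm y \<longrightarrow> f x = f y)"

text \<open>\<open>C_diff k f\<close>: the function \<open>f\<close> is \<open>k\<close> times differentiable on the whole space, with all
  iterated directional derivatives of order \<open>k\<close> continuous, i.e. \<open>f\<close> is of class \<open>C\<^sup>k\<close>.\<close>

primrec C_diff :: "nat \<Rightarrow> ('a::euclidean_space \<Rightarrow> real) \<Rightarrow> bool" where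
  "C_diff 0 f \<longleftrightarrow> continuous_on UNIV f"
| "C_diff (Suc k) f \<longleftrightarrow>
     (\<forall>x. f differentiable (at x)) \<and> (\<forall>v. C_diff k (\<lambda>x. frechet_derivative f (at x) v))"

definition smooth :: "('a::euclidean_space \<Rightarrow> real) \<Rightarrow> bool" where
  "smooth f \<longleftrightarrow> (\<forall>k. C_diff k f)"

definition smooth_radial_measure :: "('a::euclidean_space) measure \<Rightarrow> bool" where
  "smooth_radial_measure \<rho> \<longleftrightarrow>
     (\<exists>f. smooth f \<and> radial f \<and> (\<forall>x. 0 \<le> f x) \<and> \<rho> = density lborel (\<lambda>x. ennreal (f x)))"

text \<open>The measure is carried by the set \<open>S\<close>; for closed \<open>S\<close> this says that the topological support
  is contained in \<open>S\<close>.\<close>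

definition supported_on :: "('a::euclidean_space) measure \<Rightarrow> 'a set \<Rightarrow> bool" where
  "supported_on \<rho> S \<longleftrightarrow> emeasure \<rho> (- S) = 0"

end

theory Submission
  imports Defs
begin

text \<open>Write \<open>W\<close> for the power potential, \<open>d\<close> for the dimension and \<open>I(\<rho>, \<sigma>) = \<integral>\<integral> W (x - y) d\<sigma> d\<rho>\<close>.
The external potential is taken of the form \<open>U = - W * \<nu>\<close> with a positive measure \<open>\<nu>\<close> of
total mass \<open>m < 1\<close>. Completing the square gives \<open>E[\<rho>] = I(\<rho> - \<nu>, \<rho> - \<nu>) / 2 - I(\<nu>, \<nu>) / 2\<close>.

No minimizer exists because the square can be made small but never zero. The kernel is positive
definite, and strictly so on differences of measures of different mass: it is a superposition of
products \<open>\<phi>\<^sub>p(x) \<phi>\<^sub>p(y)\<close> of Gaussians (\<open>riesz_kernel_eq_features\<close>), so \<open>I(\<rho> - \<nu>, \<rho> - \<nu>)\<close> is the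
integral of the squares of \<open>\<integral>\<phi>\<^sub>p d\<rho> - \<integral>\<phi>\<^sub>p d\<nu>\<close>, and as the Gaussians flatten out these differences
tend to \<open>1 - m \<noteq> 0\<close> (\<open>mutual_energy_strict\<close>). On the other hand \<open>\<nu>\<close> plus the missing mass \<open>1 - m\<close>,
spread uniformly over a huge ball, has a square as small as desired (\<open>spread_density\<close>). Both facts
together are \<open>no_minimizer_subunit_background\<close>.

A measure of mass one whose generated potential is negative on its support exists because \<open>W\<close> is
strictly superharmonic, which is where \<open>2 - d < b\<close> enters. Take \<open>\<nu> = m \<eta>\<close> with a normalized bump \<open>\<eta>\<close>
and \<open>\<rho> = \<eta> + l \<Delta>\<psi>\<close> with a smaller bump \<open>\<psi> \<ge> 0\<close> and \<open>l > 0\<close> so small that \<open>\<rho> \<ge> 0\<close>. Adding a Laplacian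
does not change the mass, but it lowers the potential by
\<open>W * \<Delta>\<psi> = (\<Delta>W) * \<psi> < 0\<close>, uniformly on bounded sets (\<open>riesz_superharmonic\<close>). Hence
\<open>W * \<rho> + U = (1 - m) W * \<eta> + l W * \<Delta>\<psi>\<close> is negative on the ball once \<open>m\<close> is close enough to one.

Smoothness of \<open>U\<close> comes from differentiating \<open>W * \<eta>\<close> under the integral sign, with all derivatives
falling on \<open>\<eta>\<close> (\<open>smooth_convolution\<close>), and its radial symmetry from the invariance of Lebesgue measure
under reflections (\<open>convolution_radial\<close>).\<close>

section \<open>Calculus of smooth functions\<close>

lemma C_diff_SucI:
  assumes "\<And>x. (f has_derivative f' x) (at x)"
    and "\<And>v. C_diff k (\<lambda>x. f' x v)"
  shows "C_diff (Suc k) f"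
proof -
  have "frechet_derivative f (at x) = f' x" for x
    using frechet_derivative_at[OF assms(1)] by simp
  then show ?thesis
    using assms by (auto simp: differentiable_def)
qed

lemma C_diff_SucD:
  assumes "C_diff (Suc k) f"
  shows "(f has_derivative frechet_derivative f (at x)) (at x)"
    and "C_diff k (\<lambda>x. frechet_derivative f (at x) v)"
  using assms by (auto simp: frechet_derivative_works)

text \<open>The definition of \<^const>\<open>C_diff\<close> asks for continuity only at the top order; continuity of the lower
derivatives follows because a differentiable function is continuous. The product rule depends on
this, since it leaves one factor undifferentiated.\<close>

lemma C_diff_lower: "C_diff (Suc k) f \<Longrightarrow> C_diff k f"
proof (induction k arbitrary: f)
  case 0
  then show ?case
    by (auto intro!: continuous_at_imp_continuous_on differentiable_imp_continuous_within)
next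
  case (Suc k)
  have "C_diff (Suc k) (\<lambda>x. frechet_derivative f (at x) v)" for v
    by (rule C_diff_SucD(2)[OF Suc.prems])
  then have "C_diff k (\<lambda>x. frechet_derivative f (at x) v)" for v
    by (rule Suc.IH)
  with C_diff_SucD(1)[OF Suc.prems] show ?case
    by (intro C_diff_SucI) auto
qed

lemma C_diff_const: "C_diff k (\<lambda>_. c)"
proof (induction k arbitrary: c)
  case (Suc k)
  show ?case
    by (rule C_diff_SucI[where f' = "\<lambda>_ _. 0"]) (auto intro: Suc)
qed simp

lemma C_diff_add: "C_diff k f \<Longrightarrow> C_diff k g \<Longrightarrow> C_diff k (\<lambda>x. f x + g x)"
proof (induction k arbitrary: f g)
  case (Suc k)
  show ?case
    by (rule C_diff_SucI[OF has_derivative_add[OF C_diff_SucD(1)[OF Suc.prems(1)]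
            C_diff_SucD(1)[OF Suc.prems(2)]]])
      (intro Suc.IH C_diff_SucD(2)[OF Suc.prems(1)] C_diff_SucD(2)[OF Suc.prems(2)])
qed (auto intro: continuous_on_add)

lemma C_diff_mult: "C_diff k f \<Longrightarrow> C_diff k g \<Longrightarrow> C_diff k (\<lambda>x. f x * g x)"
proof (induction k arbitrary: f g)
  case (Suc k)
  show ?case
    by (rule C_diff_SucI[OF has_derivative_mult[OF C_diff_SucD(1)[OF Suc.prems(1)]
            C_diff_SucD(1)[OF Suc.prems(2)]]])
      (intro C_diff_add Suc.IH C_diff_lower[OF Suc.prems(1)] C_diff_lower[OF Suc.prems(2)]
        C_diff_SucD(2)[OF Suc.prems(1)] C_diff_SucD(2)[OF Suc.prems(2)])
qed (auto intro: continuous_on_mult)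

lemma smooth_const: "smooth (\<lambda>_. c)"
  by (simp add: smooth_def C_diff_const)

lemma smooth_add: "smooth f \<Longrightarrow> smooth g \<Longrightarrow> smooth (\<lambda>x. f x + g x)"
  by (simp add: smooth_def C_diff_add)

lemma smooth_mult: "smooth f \<Longrightarrow> smooth g \<Longrightarrow> smooth (\<lambda>x. f x * g x)"
  by (simp add: smooth_def C_diff_mult)

lemma smooth_has_derivative:
  "smooth f \<Longrightarrow> (f has_derivative frechet_derivative f (at x)) (at x)"
  using C_diff_SucD(1)[of 0 f] by (auto simp: smooth_def)

lemma smooth_derivative: "smooth f \<Longrightarrow> smooth (\<lambda>x. frechet_derivative f (at x) v)"
  using C_diff_SucD(2)[of _ f v] unfolding smooth_def by blast

lemma smooth_continuous_on: "smooth f \<Longrightarrow> continuous_on S f"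
  by (metis C_diff.simps(1) smooth_def continuous_on_subset subset_UNIV)

lemma smooth_measurable [measurable_dest]: "smooth f \<Longrightarrow> f \<in> borel_measurable borel"
  by (intro borel_measurable_continuous_onI smooth_continuous_on)

lemma C_diff_inner_right: "C_diff k (\<lambda>x. x \<bullet> v)"
proof (cases k)
  case 0
  then show ?thesis by (auto intro!: continuous_intros)
next
  case (Suc j)
  show ?thesis unfolding Suc
    by (rule C_diff_SucI[where f' = "\<lambda>_ h. h \<bullet> v"])
      (auto intro!: derivative_eq_intros C_diff_const)
qed

lemma has_derivative_norm_sq:
  fixes a x :: "'a::euclidean_space"
  shows "((\<lambda>x. (norm (x - a))\<^sup>2) has_derivative (\<lambda>h. 2 * ((x - a) \<bullet> h))) (at x)"
  unfolding power2_norm_eq_inner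
  by (auto intro!: derivative_eq_intros simp: inner_commute)

lemma smooth_norm_sq: "smooth (\<lambda>x::'a::euclidean_space. (norm (x - a))\<^sup>2)"
  unfolding smooth_def
proof
  fix k
  have "C_diff k (\<lambda>x::'a. x \<bullet> v + (- (a \<bullet> v)))" for v
    by (intro C_diff_add C_diff_const C_diff_inner_right)
  then have "C_diff (Suc k) (\<lambda>x::'a. (norm (x - a))\<^sup>2)"
    by (intro C_diff_SucI[OF has_derivative_norm_sq] C_diff_mult C_diff_const)
      (simp add: inner_diff_left)
  then show "C_diff k (\<lambda>x::'a. (norm (x - a))\<^sup>2)" by (rule C_diff_lower)
qed

text \<open>The outer function comes with the sequence of all its derivatives, so that the chain rule just
  moves along this sequence and an induction over the order of differentiability closes.\<close>

lemma smooth_compose_derivative_sequence: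
  assumes q: "smooth q" and S: "\<And>x. q x \<in> S"
    and \<phi>: "\<And>j t. t \<in> S \<Longrightarrow> (\<phi> j has_real_derivative \<phi> (Suc j) t) (at t)"
  shows "smooth (\<lambda>x. \<phi> j (q x))"
proof -
  have "C_diff k (\<lambda>x. \<phi> j (q x))" for k
  proof (induction k arbitrary: j)
    case 0
    have "continuous_on S (\<phi> j)"
      by (intro continuous_at_imp_continuous_on ballI DERIV_isCont[OF \<phi>])
    then show ?case
      using smooth_continuous_on[OF q, of UNIV] continuous_on_compose2[of S "\<phi> j" UNIV q] S by auto
  next
    case (Suc k)
    have d: "((\<lambda>x. \<phi> j (q x)) has_derivative
        (\<lambda>h. \<phi> (Suc j) (q x) * frechet_derivative q (at x) h)) (at x)" for x
      using has_derivative_compose[OF smooth_has_derivative[OF q]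
          \<phi>[OF S, unfolded has_field_derivative_def]]
      by (simp add: mult.commute)
    show ?case
      by (rule C_diff_SucI[OF d])
        (use Suc smooth_derivative[OF q] in \<open>auto intro!: C_diff_mult simp: smooth_def\<close>)
  qed
  then show ?thesis by (simp add: smooth_def)
qed

section \<open>Smooth bumps\<close>

text \<open>The derivatives of \<open>exp (- 1 / t)\<close> are \<open>p (1 / t) exp (- 1 / t)\<close> with polynomials \<open>p\<close>; differentiating
once more replaces \<open>p\<close> by \<open>s\<^sup>2 (p - p')\<close>, where \<open>s\<close> stands for \<open>1 / t\<close>.\<close>

fun flat_poly :: "nat \<Rightarrow> real poly" where
  "flat_poly 0 = 1"
| "flat_poly (Suc j) = [:0, 0, 1:] * (flat_poly j - pderiv (flat_poly j))"

definition flat_fun :: "nat \<Rightarrow> real \<Rightarrow> real" where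
  "flat_fun j t = (if t > 0 then poly (flat_poly j) (1 / t) * exp (- 1 / t) else 0)"

lemma tendsto_poly_div_exp_0: "((\<lambda>x. poly p x / exp x) \<longlongrightarrow> (0::real)) at_top"
proof (induction p rule: pCons_induct)
  case (pCons a p)
  have "((\<lambda>x::real. x * poly p x / exp x) \<longlongrightarrow> 0) at_top"
  proof -
    have "((\<lambda>x::real. (\<Sum>i\<le>degree p. coeff p i * (x ^ Suc i / exp x))) \<longlongrightarrow> (\<Sum>i\<le>degree p. coeff p i * 0)) at_top"
      by (intro tendsto_intros tendsto_power_div_exp_0)
    then show ?thesis
      by (simp add: poly_altdef sum_distrib_left sum_divide_distrib mult_ac)
  qed
  moreover have "((\<lambda>x::real. a * (x ^ 0 / exp x)) \<longlongrightarrow> a * 0) at_top"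
    by (intro tendsto_intros tendsto_power_div_exp_0)
  ultimately show ?case
    using tendsto_add by (fastforce simp: add_divide_distrib)
qed simp

text \<open>The only delicate point is the origin, where the right difference quotient tends to zero because
\<open>exp\<close> beats every polynomial in \<open>1 / t\<close>.\<close>

lemma flat_has_derivative: "(flat_fun j has_real_derivative flat_fun (Suc j) t) (at t)"
proof -
  consider "t > 0" | "t < 0" | "t = 0" by linarith
  then show ?thesis
  proof cases
    case 1
    have "((\<lambda>t. poly (flat_poly j) (1 / t) * exp (- 1 / t)) has_real_derivative flat_fun (Suc j) t) (at t)"
      using 1 by (auto intro!: derivative_eq_intros poly_DERIV[THEN DERIV_chain2]
          simp: flat_fun_def field_simps power2_eq_square)
    then show ?thesis
      by (rule has_field_derivative_transform_within_open[where S = "{0<..}"])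
        (use 1 in \<open>auto simp: flat_fun_def\<close>)
  next
    case 2
    have "((\<lambda>t. 0) has_real_derivative flat_fun (Suc j) t) (at t)"
      using 2 by (auto simp: flat_fun_def)
    then show ?thesis
      by (rule has_field_derivative_transform_within_open[where S = "{..<0}"])
        (use 2 in \<open>auto simp: flat_fun_def\<close>)
  next
    case 3
    have "((\<lambda>x. poly ([:0, 1:] * flat_poly j) x / exp x) \<longlongrightarrow> 0) at_top"
      by (rule tendsto_poly_div_exp_0)
    then have "((\<lambda>h. poly ([:0, 1:] * flat_poly j) (inverse h) / exp (inverse h)) \<longlongrightarrow> 0) (at_right (0::real))"
      by (rule filterlim_compose[OF _ filterlim_inverse_at_top_right])
    then have "((\<lambda>h. (flat_fun j (0 + h) - flat_fun j 0) / h) \<longlongrightarrow> 0) (at_right 0)"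
      by (rule Lim_transform_eventually)
        (auto simp: eventually_at_filter flat_fun_def field_simps exp_minus)
    moreover have "((\<lambda>h. (flat_fun j (0 + h) - flat_fun j 0) / h) \<longlongrightarrow> 0) (at_left 0)"
      by (rule Lim_transform_eventually[OF tendsto_const])
        (auto simp: eventually_at_filter flat_fun_def)
    ultimately show ?thesis
      unfolding 3 DERIV_def by (simp add: filterlim_split_at flat_fun_def)
  qed
qed

lemma flat_nonpos: "t \<le> 0 \<Longrightarrow> flat_fun j t = 0"
  by (simp add: flat_fun_def)

lemma flat_0: "flat_fun 0 t = (if t > 0 then exp (- 1 / t) else 0)"
  by (simp add: flat_fun_def)

lemma flat_0_mono: "s \<le> t \<Longrightarrow> flat_fun 0 s \<le> flat_fun 0 t"
  by (auto simp: flat_0 field_simps)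

text \<open>The square of the norm, unlike the norm, is smooth at the centre, so radial functions are built from it.\<close>

lemma smooth_flat_norm: "smooth (\<lambda>x::'a::euclidean_space. flat_fun j (c - (norm (x - a))\<^sup>2))"
proof (rule smooth_compose_derivative_sequence[where \<phi> = flat_fun and S = UNIV, OF _ _ flat_has_derivative])
  have "smooth (\<lambda>x::'a. c + (- 1) * (norm (x - a))\<^sup>2)"
    by (intro smooth_add smooth_mult smooth_const smooth_norm_sq)
  then show "smooth (\<lambda>x::'a. c - (norm (x - a))\<^sup>2)" by simp
qed simp

section \<open>Convolution with a smooth function of compact support\<close>

definition locally_integrable :: "('a::euclidean_space \<Rightarrow> real) \<Rightarrow> bool" where
  "locally_integrable g \<longleftrightarrow> (\<forall>r. set_integrable lborel (cball 0 r) g)"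

lemma locally_integrable_measurable:
  fixes g :: "'a::euclidean_space \<Rightarrow> real"
  assumes "locally_integrable g" shows "g \<in> borel_measurable borel"
proof (rule borel_measurable_LIMSEQ_real)
  fix x :: 'a
  have "\<forall>\<^sub>F n in sequentially. norm x \<le> real n"
    using eventually_ge_at_top[of "nat \<lceil>norm x\<rceil>"] by eventually_elim linarith
  then show "(\<lambda>n. indicator (cball 0 (real n)) x * g x) \<longlonglongrightarrow> g x"
    by (intro tendsto_eventually) (auto elim!: eventually_mono simp: indicator_def)
next
  show "(\<lambda>x. indicator (cball 0 (real n)) x * g x) \<in> borel_measurable borel" for n
    using assms borel_measurable_integrable
    by (fastforce simp: locally_integrable_def set_integrable_def)
qed

lemma continuous_locally_integrable:
  fixes g :: "'a::euclidean_space \<Rightarrow> real"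
  shows "continuous_on UNIV g \<Longrightarrow> locally_integrable g"
  unfolding locally_integrable_def set_integrable_def
  by (intro allI borel_integrable_compact) (auto intro: continuous_on_subset)

lemma compact_support_bounded:
  fixes h :: "'a::euclidean_space \<Rightarrow> real"
  assumes "continuous_on UNIV h" and "\<And>x. norm x > R \<Longrightarrow> h x = 0"
  obtains B where "B \<ge> 0" "\<And>x. \<bar>h x\<bar> \<le> B"
proof -
  have "bounded (h ` cball 0 R)"
    by (intro compact_imp_bounded compact_continuous_image continuous_on_subset[OF assms(1)]) auto
  then obtain B where B: "\<forall>x\<in>cball 0 R. \<bar>h x\<bar> \<le> B"
    by (auto simp: bounded_iff)
  have "\<bar>h x\<bar> \<le> max B 0" for x
    using B assms(2)[of x] by (cases "norm x \<le> R") (auto simp: le_max_iff_disj)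
  then show ?thesis using that[of "max B 0"] by auto
qed

lemma integrable_convolution:
  fixes g h :: "'a::euclidean_space \<Rightarrow> real"
  assumes g: "locally_integrable g"
    and h: "h \<in> borel_measurable borel" "\<And>x. \<bar>h x\<bar> \<le> B" "\<And>x. norm x > R \<Longrightarrow> h x = 0"
  shows "integrable lborel (\<lambda>z. g z * h (x - z))"
proof (rule Bochner_Integration.integrable_bound)
  show "integrable lborel (\<lambda>z. B * (indicator (cball 0 (R + norm x)) z * g z))"
    using g by (auto simp: locally_integrable_def set_integrable_def)
  note locally_integrable_measurable[OF g, measurable] h(1)[measurable]
  show "(\<lambda>z. g z * h (x - z)) \<in> borel_measurable lborel" by measurable
  have B: "0 \<le> B" using h(2)[of 0] by linarith
  have "\<bar>g z * h (x - z)\<bar> \<le> \<bar>B * (indicator (cball 0 (R + norm x)) z * g z)\<bar>" for z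
  proof (cases "norm z \<le> R + norm x")
    case True
    have "\<bar>g z\<bar> * \<bar>h (x - z)\<bar> \<le> \<bar>g z\<bar> * B" by (intro mult_left_mono h) auto
    then show ?thesis using True B by (simp add: abs_mult mult.commute)
  next
    case False
    then have "norm (x - z) > R" using norm_triangle_ineq2[of z x] by (simp add: norm_minus_commute)
    then show ?thesis by (simp add: h(3))
  qed
  then show "AE z in lborel. norm (g z * h (x - z)) \<le> norm (B * (indicator (cball 0 (R + norm x)) z * g z))"
    by simp
qed

lemma support_derivative:
  fixes h :: "'a::euclidean_space \<Rightarrow> real"
  assumes "\<And>x. norm x > R \<Longrightarrow> h x = 0" "norm x > R"
  shows "frechet_derivative h (at x) v = 0"
proof -
  have "(h has_derivative (\<lambda>_. 0)) (at x)"
  proof (rule has_derivative_transform_within_open[of "\<lambda>_. 0"])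
    show "open {x::'a. norm x > R}" by (intro open_Collect_less continuous_intros)
  qed (use assms in auto)
  from frechet_derivative_at[OF this] show ?thesis by metis
qed

lemma derivative_uniform_bound:
  fixes h :: "'a::euclidean_space \<Rightarrow> real"
  assumes h: "smooth h" and supp: "\<And>x. norm x > R \<Longrightarrow> h x = 0"
  obtains L where "L \<ge> 0" "\<And>x v. \<bar>frechet_derivative h (at x) v\<bar> \<le> L * norm v"
    "\<And>x y. \<bar>h y - h x\<bar> \<le> L * norm (y - x)"
proof -
  let ?D = "\<lambda>x. frechet_derivative h (at x)"
  have "\<exists>B. \<forall>x. \<bar>?D x i\<bar> \<le> B" for i
    by (rule compact_support_bounded[of "\<lambda>x. ?D x i" R])
      (use smooth_continuous_on[OF smooth_derivative[OF h]] support_derivative[OF supp] in auto)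
  then obtain B where B: "\<And>i x. \<bar>?D x i\<bar> \<le> B i" by metis
  define L where "L = (\<Sum>i\<in>Basis. B i)"
  have B0: "B i \<ge> 0" for i using B[of 0 i] by linarith
  have lin: "linear (?D x)" for x
    using smooth_has_derivative[OF h] has_derivative_linear by blast
  have bd: "\<bar>?D x v\<bar> \<le> L * norm v" for x v
  proof -
    have "?D x v = (\<Sum>i\<in>Basis. (v \<bullet> i) * ?D x i)"
      by (subst euclidean_representation[of v, symmetric])
        (simp only: linear_sum[OF lin] linear_scale[OF lin] real_scaleR_def)
    also have "\<bar>\<dots>\<bar> \<le> (\<Sum>i\<in>Basis. norm v * B i)"
      by (rule order_trans[OF sum_abs sum_mono])
        (auto simp: abs_mult intro!: mult_mono B Basis_le_norm)
    finally show ?thesis by (simp add: L_def sum_distrib_left mult.commute)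
  qed
  have "norm (h y - h x) \<le> L * norm (y - x)" for x y
    by (rule differentiable_bound[of UNIV h ?D])
      (use bd smooth_has_derivative[OF h] B0 in \<open>auto intro!: onorm_le\<close>)
  moreover have "L \<ge> 0" unfolding L_def by (intro sum_nonneg B0)
  ultimately show ?thesis using that[of L] bd by auto
qed

text \<open>Dominated convergence along sequences: the difference quotients of \<open>h\<close> are bounded by its Lipschitz
constant, and all of them vanish outside one ball, on which \<open>g\<close> is integrable.\<close>

lemma convolution_has_derivative:
  fixes g h :: "'a::euclidean_space \<Rightarrow> real"
  assumes g: "locally_integrable g" and h: "smooth h" and supp: "\<And>x. norm x > R \<Longrightarrow> h x = 0"
  shows "((\<lambda>x. \<integral>z. g z * h (x - z) \<partial>lborel) has_derivative
    (\<lambda>v. \<integral>z. g z * frechet_derivative h (at (x - z)) v \<partial>lborel)) (at x)"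
proof -
  let ?D = "\<lambda>x. frechet_derivative h (at x)"
  obtain L where L: "L \<ge> 0" "\<And>x v. \<bar>?D x v\<bar> \<le> L * norm v" "\<And>x y. \<bar>h y - h x\<bar> \<le> L * norm (y - x)"
    by (rule derivative_uniform_bound[of h R, OF h supp]) (assumption, rule that, assumption+)
  obtain B where B: "B \<ge> 0" "\<And>x. \<bar>h x\<bar> \<le> B"
    by (rule compact_support_bounded[of h R, OF smooth_continuous_on[OF h] supp]) (assumption, rule that)
  note [measurable] = locally_integrable_measurable[OF g] smooth_measurable[OF h]
    smooth_measurable[OF smooth_derivative[OF h]]
  have lin: "linear (?D x)" for x
    using smooth_has_derivative[OF h] has_derivative_linear by blast
  have int0: "integrable lborel (\<lambda>z. g z * h (x - z))" for x
    by (rule integrable_convolution[OF g _ B(2) supp]) auto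
  have int1: "integrable lborel (\<lambda>z. g z * ?D (x - z) v)" for x v
    by (rule integrable_convolution[OF g, of "\<lambda>x. ?D x v" "L * norm v" R])
      (auto intro: L support_derivative[OF supp])
  have "linear (\<lambda>v. \<integral>z. g z * ?D (x - z) v \<partial>lborel)"
    by (rule linearI) (use int1 in \<open>simp_all add: linear_add[OF lin] linear_scale[OF lin]
        distrib_left mult.left_commute\<close>)
  moreover have "((\<lambda>y. ((\<integral>z. g z * h (y - z) \<partial>lborel) - (\<integral>z. g z * h (x - z) \<partial>lborel) -
      (\<integral>z. g z * ?D (x - z) (y - x) \<partial>lborel)) /\<^sub>R norm (y - x)) \<longlongrightarrow> 0) (at x)"
    unfolding tendsto_at_iff_sequentially o_def
  proof (intro allI impI)
    fix X :: "nat \<Rightarrow> 'a"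
    assume ne: "\<forall>i. X i \<in> UNIV - {x}" and X: "X \<longlonglongrightarrow> x"
    obtain M where M: "\<And>i. norm (X i) \<le> M"
      using convergent_imp_bounded[OF X] by (auto simp: bounded_iff)
    let ?q = "\<lambda>i z. g z * ((h (X i - z) - h (x - z) - ?D (x - z) (X i - x)) / norm (X i - x))"
    have eq: "((\<integral>z. g z * h (X i - z) \<partial>lborel) - (\<integral>z. g z * h (x - z) \<partial>lborel) -
      (\<integral>z. g z * ?D (x - z) (X i - x) \<partial>lborel)) /\<^sub>R norm (X i - x) = (\<integral>z. ?q i z \<partial>lborel)" for i
    proof -
      have "?q i z = (g z * h (X i - z) - g z * h (x - z) - g z * ?D (x - z) (X i - x)) / norm (X i - x)" for z
        by (simp add: algebra_simps)
      then have "(\<integral>z. ?q i z \<partial>lborel) = (\<integral>z. (g z * h (X i - z) - g z * h (x - z) -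
          g z * ?D (x - z) (X i - x)) / norm (X i - x) \<partial>lborel)"
        by (intro Bochner_Integration.integral_cong refl)
      also have "\<dots> = ((\<integral>z. g z * h (X i - z) \<partial>lborel) - (\<integral>z. g z * h (x - z) \<partial>lborel) -
          (\<integral>z. g z * ?D (x - z) (X i - x) \<partial>lborel)) / norm (X i - x)"
        by (simp only: integral_divide_zero Bochner_Integration.integral_diff int0 int1
            Bochner_Integration.integrable_diff)
      finally show ?thesis by (simp add: divide_inverse_commute)
    qed
    have "(\<lambda>i. \<integral>z. ?q i z \<partial>lborel) \<longlonglongrightarrow> (\<integral>z. 0 \<partial>(lborel :: 'a measure))"
    proof (rule integral_dominated_convergence)
      show "integrable lborel (\<lambda>z. (2 * L) * \<bar>indicator (cball 0 (R + M + norm x)) z * g z\<bar>)"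
        using g by (auto simp: locally_integrable_def set_integrable_def)
      have "(\<lambda>i. ?q i z) \<longlonglongrightarrow> 0" for z
      proof -
        have "((\<lambda>y. (h y - h (x - z) - ?D (x - z) (y - (x - z))) /\<^sub>R norm (y - (x - z))) \<longlongrightarrow> 0) (at (x - z))"
          using smooth_has_derivative[OF h] unfolding has_derivative_at_within by blast
        moreover have "(\<lambda>i. X i - z) \<longlonglongrightarrow> x - z" by (intro tendsto_intros X)
        ultimately have "(\<lambda>i. (h (X i - z) - h (x - z) - ?D (x - z) (X i - z - (x - z))) /\<^sub>R
            norm (X i - z - (x - z))) \<longlonglongrightarrow> 0"
          using ne unfolding tendsto_at_iff_sequentially o_def by (elim allE[of _ "\<lambda>i. X i - z"]) auto
        then have "(\<lambda>i. g z * ((h (X i - z) - h (x - z) - ?D (x - z) (X i - x)) / norm (X i - x))) \<longlonglongrightarrow> g z * 0"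
          by (intro tendsto_intros) (simp add: divide_inverse_commute)
        then show ?thesis by simp
      qed
      then show "AE z in lborel. (\<lambda>i. ?q i z) \<longlonglongrightarrow> 0" by simp
      show "AE z in lborel. norm (?q i z) \<le> (2 * L) * \<bar>indicator (cball 0 (R + M + norm x)) z * g z\<bar>" for i
      proof (rule AE_I2)
        fix z
        show "norm (?q i z) \<le> (2 * L) * \<bar>indicator (cball 0 (R + M + norm x)) z * g z\<bar>"
        proof (cases "norm z \<le> R + M + norm x")
          case True
          have n: "norm (X i - x) > 0" using ne by auto
          have "\<bar>h (X i - z) - h (x - z)\<bar> \<le> L * norm (X i - x)"
            using L(3)[of "X i - z" "x - z"] by simp
          with L(2)[of "x - z" "X i - x"]
          have "\<bar>h (X i - z) - h (x - z) - ?D (x - z) (X i - x)\<bar> \<le> 2 * L * norm (X i - x)" by linarith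
          then have "\<bar>(h (X i - z) - h (x - z) - ?D (x - z) (X i - x)) / norm (X i - x)\<bar> \<le> 2 * L"
            using n by (simp add: field_simps)
          then have "\<bar>g z\<bar> * \<bar>(h (X i - z) - h (x - z) - ?D (x - z) (X i - x)) / norm (X i - x)\<bar> \<le> \<bar>g z\<bar> * (2 * L)"
            by (intro mult_left_mono) auto
          then show ?thesis using True L(1) by (simp add: abs_mult mult.commute)
        next
          case False
          have "norm (X i - z) > R" "norm (x - z) > R"
            using False M[of i] norm_triangle_ineq2[of z x] norm_triangle_ineq2[of z "X i"]
              norm_ge_zero[of x] norm_ge_zero[of "X i"] norm_minus_commute[of z x]
              norm_minus_commute[of z "X i"]
            by linarith+
          then show ?thesis using support_derivative[of R h, OF supp] False by (simp add: supp)
        qed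
      qed
    qed (use ne in measurable)
    then show "(\<lambda>i. ((\<integral>z. g z * h (X i - z) \<partial>lborel) - (\<integral>z. g z * h (x - z) \<partial>lborel) -
      (\<integral>z. g z * ?D (x - z) (X i - x) \<partial>lborel)) /\<^sub>R norm (X i - x)) \<longlonglongrightarrow> 0"
      by (simp only: eq Bochner_Integration.integral_zero)
  qed
  ultimately show ?thesis
    by (simp add: has_derivative_at_within linear_conv_bounded_linear)
qed

theorem smooth_convolution:
  fixes g h :: "'a::euclidean_space \<Rightarrow> real"
  assumes g: "locally_integrable g" and h: "smooth h" and supp: "\<And>x. norm x > R \<Longrightarrow> h x = 0"
  shows "smooth (\<lambda>x. \<integral>z. g z * h (x - z) \<partial>lborel)"
proof -
  have "C_diff k (\<lambda>x. \<integral>z. g z * h (x - z) \<partial>lborel)" for k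
    using h supp
  proof (induction k arbitrary: h)
    case 0
    show ?case
      using has_derivative_continuous[OF convolution_has_derivative[OF g 0]]
      by (auto intro: continuous_at_imp_continuous_on)
  next
    case (Suc k)
    show ?case
      by (rule C_diff_SucI[OF convolution_has_derivative[OF g Suc.prems]])
        (auto intro!: Suc.IH smooth_derivative Suc.prems(1) support_derivative[OF Suc.prems(2)])
  qed
  then show ?thesis by (simp add: smooth_def)
qed

lemma lborel_distr_reflect: "distr lborel borel (\<lambda>z. x - z) = (lborel :: 'a::euclidean_space measure)"
  by (subst lborel_affine[of "-1" x]) (auto simp: density_1 one_ennreal_def[symmetric])

lemma lborel_integral_reflect:
  fixes f :: "'a::euclidean_space \<Rightarrow> real"
  assumes [measurable]: "f \<in> borel_measurable borel"
  shows "(\<integral>z. f (x - z) \<partial>lborel) = (\<integral>z. f z \<partial>lborel)"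
  by (subst (2) lborel_distr_reflect[symmetric, of x]) (simp add: integral_distr)

lemma nn_integral_reflect:
  fixes f :: "'a::euclidean_space \<Rightarrow> ennreal"
  assumes [measurable]: "f \<in> borel_measurable borel"
  shows "(\<integral>\<^sup>+z. f (x - z) \<partial>lborel) = (\<integral>\<^sup>+z. f z \<partial>lborel)"
  by (subst (2) lborel_distr_reflect[symmetric, of x]) (simp add: nn_integral_distr)

text \<open>The convolution of \<open>h\<close> with the constant one is constant by translation invariance, and its derivative
is the integral in question.\<close>

lemma integral_derivative_eq_0:
  fixes h :: "'a::euclidean_space \<Rightarrow> real"
  assumes h: "smooth h" and supp: "\<And>x. norm x > R \<Longrightarrow> h x = 0"
  shows "(\<integral>z. frechet_derivative h (at z) v \<partial>lborel) = 0"
proof -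
  note [measurable] = smooth_measurable[OF h] smooth_measurable[OF smooth_derivative[OF h]]
  have "((\<lambda>x. \<integral>z. 1 * h (x - z) \<partial>lborel) has_derivative
    (\<lambda>v. \<integral>z. 1 * frechet_derivative h (at (0 - z)) v \<partial>lborel)) (at 0)"
    by (rule convolution_has_derivative[OF _ h supp]) (auto intro: continuous_locally_integrable)
  moreover have "(\<integral>z. h (x - z) \<partial>lborel) = (\<integral>z. h z \<partial>lborel)" for x
    by (rule lborel_integral_reflect) measurable
  ultimately have "((\<lambda>x::'a. \<integral>z. h z \<partial>lborel) has_derivative
    (\<lambda>v. \<integral>z. frechet_derivative h (at (0 - z)) v \<partial>lborel)) (at 0)"
    by simp
  from has_derivative_unique[OF this has_derivative_const]
  have "(\<integral>z. frechet_derivative h (at (0 - z)) v \<partial>lborel) = 0" by metis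
  then show ?thesis
    using lborel_integral_reflect[of "\<lambda>z. frechet_derivative h (at z) v" 0] by simp
qed

lemma integrable_mult_compact_support:
  fixes f h :: "'a::euclidean_space \<Rightarrow> real"
  assumes "continuous_on UNIV f" "continuous_on UNIV h" "\<And>x. norm x > R \<Longrightarrow> h x = 0"
  shows "integrable lborel (\<lambda>z. f z * h z)"
proof -
  have "integrable lborel (\<lambda>z. indicator (cball 0 R) z *\<^sub>R (f z * h z))"
    by (rule borel_integrable_compact)
      (intro compact_cball continuous_on_mult continuous_on_subset[OF assms(1)]
        continuous_on_subset[OF assms(2)] subset_UNIV)+
  moreover have "indicator (cball 0 R) z *\<^sub>R (f z * h z) = f z * h z" for z
    using assms(3)[of z] by (auto simp: indicator_def)
  ultimately show ?thesis by (simp only:)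
qed

lemma integral_by_parts:
  fixes f h :: "'a::euclidean_space \<Rightarrow> real"
  assumes f: "smooth f" and h: "smooth h" and supp: "\<And>x. norm x > R \<Longrightarrow> h x = 0"
  shows "(\<integral>z. f z * frechet_derivative h (at z) v \<partial>lborel) =
         - (\<integral>z. frechet_derivative f (at z) v * h z \<partial>lborel)"
proof -
  note int = integrable_mult_compact_support[OF smooth_continuous_on smooth_continuous_on]
  have "frechet_derivative (\<lambda>z. f z * h z) (at z) v =
      f z * frechet_derivative h (at z) v + frechet_derivative f (at z) v * h z" for z
    using frechet_derivative_at[OF has_derivative_mult[OF smooth_has_derivative[OF f] smooth_has_derivative[OF h]], of z]
    by metis
  moreover have "(\<integral>z. frechet_derivative (\<lambda>z. f z * h z) (at z) v \<partial>lborel) = 0"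
    by (rule integral_derivative_eq_0[OF smooth_mult[OF f h], of R]) (simp add: supp)
  moreover have "integrable lborel (\<lambda>z. f z * frechet_derivative h (at z) v)"
    by (rule int[of _ _ R]) (auto intro: f smooth_derivative[OF h] support_derivative[OF supp])
  moreover have "integrable lborel (\<lambda>z. frechet_derivative f (at z) v * h z)"
    by (rule int[of _ _ R]) (auto intro: smooth_derivative[OF f] h supp)
  ultimately show ?thesis by simp
qed

section \<open>The Laplacian and the superharmonicity of the power potential\<close>

definition laplacian :: "('a::euclidean_space \<Rightarrow> real) \<Rightarrow> 'a \<Rightarrow> real" where
  "laplacian f x = (\<Sum>i\<in>Basis. frechet_derivative (\<lambda>y. frechet_derivative f (at y) i) (at x) i)"

lemma C_diff_sum: "(\<And>i. i \<in> I \<Longrightarrow> C_diff k (f i)) \<Longrightarrow> C_diff k (\<lambda>x. \<Sum>i\<in>I. f i x)"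
  by (induction I rule: infinite_finite_induct) (auto intro: C_diff_add C_diff_const)

lemma smooth_laplacian: "smooth f \<Longrightarrow> smooth (laplacian f)"
  unfolding laplacian_def smooth_def
  by (intro allI C_diff_sum)
    (use smooth_derivative[OF smooth_derivative] smooth_def in blast)

lemma support_laplacian:
  fixes h :: "'a::euclidean_space \<Rightarrow> real"
  assumes "\<And>x. norm x > R \<Longrightarrow> h x = 0" "norm x > R"
  shows "laplacian h x = 0"
  unfolding laplacian_def
  by (intro sum.neutral ballI support_derivative[where R = R] assms)

text \<open>Two integrations by parts in every coordinate. Compact support is required of \<open>h\<close> alone, because \<open>f\<close>
is to be a regularized power of the norm.\<close>

theorem Green_second_identity:
  fixes f h :: "'a::euclidean_space \<Rightarrow> real"
  assumes f: "smooth f" and h: "smooth h" and supp: "\<And>x. norm x > R \<Longrightarrow> h x = 0"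
  shows "(\<integral>z. f z * laplacian h z \<partial>lborel) = (\<integral>z. laplacian f z * h z \<partial>lborel)"
proof -
  note int = integrable_mult_compact_support[OF smooth_continuous_on smooth_continuous_on]
  let ?D = "\<lambda>h i x. frechet_derivative h (at x) i"
  have h1: "smooth (?D h i)" "\<And>x. norm x > R \<Longrightarrow> ?D h i x = 0" for i
    using smooth_derivative[OF h] support_derivative[OF supp] by auto
  have h2: "smooth (?D (?D h i) i)" "\<And>x. norm x > R \<Longrightarrow> ?D (?D h i) i x = 0" for i
    using smooth_derivative[OF h1(1)] support_derivative[OF h1(2)] by auto
  have f1: "smooth (?D f i)" for i by (rule smooth_derivative[OF f])
  have f2: "smooth (?D (?D f i) i)" for i by (rule smooth_derivative[OF f1])
  have "(\<integral>z. f z * laplacian h z \<partial>lborel) = (\<Sum>i\<in>Basis. \<integral>z. f z * ?D (?D h i) i z \<partial>lborel)"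
    unfolding laplacian_def sum_distrib_left
    by (rule Bochner_Integration.integral_sum) (rule int[OF f h2])
  also have "\<dots> = (\<Sum>i\<in>Basis. \<integral>z. ?D (?D f i) i z * h z \<partial>lborel)"
    using integral_by_parts[OF f h1] integral_by_parts[OF f1 h supp] by simp
  also have "\<dots> = (\<integral>z. laplacian f z * h z \<partial>lborel)"
    unfolding laplacian_def sum_distrib_right
    by (rule Bochner_Integration.integral_sum[symmetric]) (rule int[OF f2 h supp])
  finally show ?thesis .
qed

text \<open>Profiles are functions of the squared norm rather than of the norm: the formula then has no singular
term at the centre.\<close>

lemma laplacian_radial:
  fixes a x :: "'a::euclidean_space"
  assumes \<phi>: "\<And>j t. t \<ge> 0 \<Longrightarrow> (\<phi> j has_real_derivative \<phi> (Suc j) t) (at t)"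
  shows "laplacian (\<lambda>x. \<phi> 0 ((norm (x - a))\<^sup>2)) x =
    4 * (norm (x - a))\<^sup>2 * \<phi> 2 ((norm (x - a))\<^sup>2) + 2 * real DIM('a) * \<phi> 1 ((norm (x - a))\<^sup>2)"
proof -
  have d: "((\<lambda>x. \<phi> j ((norm (x - a))\<^sup>2)) has_derivative
      (\<lambda>h. \<phi> (Suc j) ((norm (x - a))\<^sup>2) * (2 * ((x - a) \<bullet> h)))) (at x)" for j x
    using has_derivative_compose[OF has_derivative_norm_sq \<phi>[unfolded has_field_derivative_def]]
    by (simp add: mult.commute)
  have d1: "frechet_derivative (\<lambda>x. \<phi> 0 ((norm (x - a))\<^sup>2)) (at x) i =
      \<phi> (Suc 0) ((norm (x - a))\<^sup>2) * (2 * ((x - a) \<bullet> i))" for x i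
    using frechet_derivative_at[OF d[of 0 x]] by metis
  have lin: "((\<lambda>x. 2 * ((x - a) \<bullet> i)) has_derivative (\<lambda>h. 2 * (h \<bullet> i))) (at x)" for i
    by (auto intro!: derivative_eq_intros)
  have "((\<lambda>x. \<phi> (Suc 0) ((norm (x - a))\<^sup>2) * (2 * ((x - a) \<bullet> i))) has_derivative
      (\<lambda>h. \<phi> (Suc 0) ((norm (x - a))\<^sup>2) * (2 * (h \<bullet> i)) +
        \<phi> 2 ((norm (x - a))\<^sup>2) * (2 * ((x - a) \<bullet> h)) * (2 * ((x - a) \<bullet> i)))) (at x)" for i
    using has_derivative_mult[OF d lin] by (simp add: numeral_2_eq_2)
  from frechet_derivative_at[OF this, symmetric]
  have "laplacian (\<lambda>x. \<phi> 0 ((norm (x - a))\<^sup>2)) x =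
    (\<Sum>i\<in>Basis. \<phi> (Suc 0) ((norm (x - a))\<^sup>2) * (2 * (i \<bullet> i)) +
        \<phi> 2 ((norm (x - a))\<^sup>2) * (2 * ((x - a) \<bullet> i)) * (2 * ((x - a) \<bullet> i)))"
    unfolding laplacian_def d1 by simp
  also have "\<dots> = (\<Sum>i\<in>(Basis::'a set). 2 * \<phi> 1 ((norm (x - a))\<^sup>2)) +
      4 * \<phi> 2 ((norm (x - a))\<^sup>2) * (\<Sum>i\<in>Basis. ((x - a) \<bullet> i)\<^sup>2)"
    unfolding sum_distrib_left sum.distrib[symmetric]
    by (intro sum.cong refl) (simp add: power2_eq_square mult_ac)
  also have "(\<Sum>i\<in>Basis. ((x - a) \<bullet> i)\<^sup>2) = (norm (x - a))\<^sup>2"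
    unfolding power2_norm_eq_inner by (subst euclidean_inner) (simp add: power2_eq_square)
  finally show ?thesis by simp
qed

text \<open>Inside the unit ball \<open>norm z powr b - 1\<close> is the integral of \<open>- b * s powr (b - 1)\<close> over \<open>s\<close> between
\<open>norm z\<close> and one. Exchanging the integrals leaves the volume of the ball of radius \<open>s\<close>, and the
resulting power \<open>s powr (b - 1 + d)\<close> is at most one.\<close>

lemma locally_integrable_norm_powr:
  assumes "b < 0" "1 - real DIM('a) \<le> b"
  shows "locally_integrable (\<lambda>z::'a::euclidean_space. norm z powr b)"
proof -
  let ?d = "DIM('a)"
  have le: "norm z powr b \<le> 1 + (norm z powr b - 1) * indicator (ball 0 1 - {0}) z" for z :: 'a
    using assms powr_le_one_le[of "norm z"] powr_mono2'[of b 1 "norm z"]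
    by (auto simp: indicator_def not_less)
  let ?k = "\<lambda>(z::'a) s. ennreal (if norm z \<le> s \<and> s \<le> 1 then - b * s powr (b - 1) else 0)"
  have cake: "ennreal ((norm z powr b - 1) * indicator (ball 0 1 - {0}) z) \<le> (\<integral>\<^sup>+s. ?k z s \<partial>lborel)" for z :: 'a
  proof (cases "z \<in> ball 0 1 - {0}")
    case True
    have "(\<integral>\<^sup>+s. ennreal (- b * s powr (b - 1)) * indicator {norm z..1} s \<partial>lborel) =
        ennreal (- (1 powr b) - (- (norm z powr b)))"
      by (rule nn_integral_FTC_Icc)
        (use True assms less_le_trans[of 0 "norm z"] in
          \<open>auto intro!: derivative_eq_intros mult_nonpos_nonneg\<close>)
    also have "(\<integral>\<^sup>+s. ennreal (- b * s powr (b - 1)) * indicator {norm z..1} s \<partial>lborel) = (\<integral>\<^sup>+s. ?k z s \<partial>lborel)"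
      by (intro nn_integral_cong) (auto simp: indicator_def)
    finally show ?thesis using True by simp
  qed simp
  have "(\<integral>\<^sup>+z. (\<integral>\<^sup>+s. ?k z s \<partial>lborel) \<partial>lborel) = (\<integral>\<^sup>+s. (\<integral>\<^sup>+z. ?k z s \<partial>lborel) \<partial>lborel)"
    by (rule lborel_pair.Fubini'[symmetric]) measurable
  also have "\<dots> \<le> (\<integral>\<^sup>+s. ennreal (- b * unit_ball_vol ?d) * indicator {0..1::real} s \<partial>lborel)"
  proof (rule nn_integral_mono)
    fix s :: real
    show "(\<integral>\<^sup>+z. ?k z s \<partial>lborel) \<le> ennreal (- b * unit_ball_vol ?d) * indicator {0..1} s"
    proof (cases "0 < s \<and> s \<le> 1")
      case True
      have "(\<integral>\<^sup>+z. ?k z s \<partial>lborel) = (\<integral>\<^sup>+z. ennreal (- b * s powr (b - 1)) * indicator (cball 0 s) (z::'a) \<partial>lborel)"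
        using True by (intro nn_integral_cong) (auto simp: indicator_def)
      also have "\<dots> = ennreal (- b * s powr (b - 1)) * ennreal (unit_ball_vol ?d * s ^ ?d)"
        using True by (subst nn_integral_cmult_indicator) (simp_all add: emeasure_cball)
      also have "\<dots> = ennreal (- b * unit_ball_vol ?d * s powr (b - 1 + ?d))"
        using True assms
        by (subst ennreal_mult'[symmetric]) (auto simp: powr_add powr_realpow mult_ac mult_nonpos_nonneg)
      also have "\<dots> \<le> ennreal (- b * unit_ball_vol ?d * 1)"
        using True assms powr_mono2[of "b - 1 + ?d" s 1]
        by (intro ennreal_leI mult_left_mono) (auto simp: mult_nonpos_nonneg)
      finally show ?thesis using True by simp
    next
      case False
      then have "?k z s = 0" for z :: 'a
        using order_trans[OF norm_ge_zero[of z], of s] by auto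
      then have "(\<integral>\<^sup>+z. ?k z s \<partial>(lborel :: 'a measure)) = 0" by simp
      then show ?thesis by (simp only: zero_le)
    qed
  qed
  also have "\<dots> < \<infinity>"
    by (simp add: nn_integral_cmult ennreal_mult_less_top)
  finally have fin: "(\<integral>\<^sup>+z. (\<integral>\<^sup>+s. ?k z s \<partial>lborel) \<partial>lborel) < \<infinity>" .
  have int: "integrable lborel (\<lambda>z::'a. (norm z powr b - 1) * indicator (ball 0 1 - {0}) z)"
  proof (rule integrableI_nonneg)
    show "AE z::'a in lborel. 0 \<le> (norm z powr b - 1) * indicator (ball 0 1 - {0}) z"
      using assms powr_mono2'[of b _ 1] by (auto simp: indicator_def intro!: AE_I2)
    show "(\<integral>\<^sup>+z. ennreal ((norm z powr b - 1) * indicator (ball 0 1 - {0}) z) \<partial>(lborel :: 'a measure)) < \<infinity>"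
      by (rule order_le_less_trans[OF nn_integral_mono fin]) (rule cake)
    show "(\<lambda>z::'a. (norm z powr b - 1) * indicator (ball 0 1 - {0}) z) \<in> borel_measurable lborel"
      by (intro borel_measurable_times borel_measurable_indicator) auto
  qed
  show ?thesis
    unfolding locally_integrable_def set_integrable_def
  proof
    fix r :: real
    show "integrable lborel (\<lambda>z::'a. indicator (cball 0 r) z *\<^sub>R (norm z powr b))"
    proof (rule Bochner_Integration.integrable_bound)
      show "integrable lborel (\<lambda>z::'a. indicator (cball 0 r) z + (norm z powr b - 1) * indicator (ball 0 1 - {0}) z)"
        by (intro Bochner_Integration.integrable_add int integrable_real_indicator)
          (simp_all add: emeasure_bounded_finite[unfolded infinity_ennreal_def])
      have "norm (indicator (cball 0 r) z *\<^sub>R (norm z powr b)) \<le>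
          norm (indicator (cball 0 r) z + (norm z powr b - 1) * indicator (ball 0 1 - {0}) z)" for z :: 'a
      proof -
        have "0 \<le> (norm z powr b - 1) * indicator (ball 0 1 - {0}) z"
          using assms powr_mono2'[of b "norm z" 1] by (auto simp: indicator_def)
        then show ?thesis using le[of z] by (cases "z \<in> cball 0 r") auto
      qed
      then show "AE z in lborel. norm (indicator (cball 0 r) z *\<^sub>R (norm z powr b)) \<le>
          norm (indicator (cball 0 r) z + (norm z powr b - 1) * indicator (ball 0 1 - {0}) (z::'a))" by simp
      show "(\<lambda>z::'a. indicator (cball 0 r) z *\<^sub>R (norm z powr b)) \<in> borel_measurable lborel"
        by (intro borel_measurable_scaleR borel_measurable_indicator) auto
    qed
  qed
qed


definition bump :: "real \<Rightarrow> 'a::euclidean_space \<Rightarrow> real" where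
  "bump c x = flat_fun 0 (c - (norm x)\<^sup>2)"

lemma smooth_bump: "smooth (\<lambda>z. bump c (z - a))"
  unfolding bump_def by (rule smooth_flat_norm)

lemma bump_nonneg: "0 \<le> bump c x"
  by (simp add: bump_def flat_0)

lemma bump_support: "r \<ge> 0 \<Longrightarrow> norm x > r \<Longrightarrow> bump (r\<^sup>2) x = 0"
  unfolding bump_def by (rule flat_nonpos) (simp add: power_mono)

lemma laplacian_bump:
  "laplacian (\<lambda>z. bump c (z - a)) (x::'a::euclidean_space) =
    4 * (norm (x - a))\<^sup>2 * flat_fun 2 (c - (norm (x - a))\<^sup>2) -
    2 * real DIM('a) * flat_fun 1 (c - (norm (x - a))\<^sup>2)"
proof -
  have "((\<lambda>t. (- 1) ^ j * flat_fun j (c - t)) has_real_derivative (- 1) ^ Suc j * flat_fun (Suc j) (c - t)) (at t)" for j t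
    by (auto intro!: derivative_eq_intros DERIV_chain2[OF flat_has_derivative])
  from laplacian_radial[where \<phi> = "\<lambda>j t. (- 1) ^ j * flat_fun j (c - t)", OF this, of a x]
  show ?thesis by (simp add: bump_def)
qed

text \<open>With \<open>q = (norm z)\<^sup>2 + e\<close> the Laplacian equals \<open>b q powr (b / 2 - 2) ((b - 2) (norm z)\<^sup>2 + d q)\<close>.
Because \<open>b - 2\<close> is negative, replacing \<open>(norm z)\<^sup>2\<close> by \<open>q\<close> lowers the bracket to \<open>(b + d - 2) q\<close>, which is
still positive, and \<open>b\<close> is negative. The bound does not depend on the regularization \<open>e\<close>.\<close>

lemma laplacian_reg_powr_le:
  fixes z :: "'a::euclidean_space"
  assumes b: "b < 0" "2 - real DIM('a) < b" and e: "e > 0"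
    and z: "(norm z)\<^sup>2 + e \<le> M"
  shows "laplacian (\<lambda>z. ((norm z)\<^sup>2 + e) powr (b / 2)) z \<le> b * (b + real DIM('a) - 2) * M powr (b / 2 - 1)"
proof -
  let ?d = "real DIM('a)"
  define \<phi> where "\<phi> = (\<lambda>j t. (\<Prod>i<j. b / 2 - real i) * (t + e) powr (b / 2 - real j))"
  have "(\<phi> j has_real_derivative \<phi> (Suc j) t) (at t)" if "t \<ge> 0" for j t
    unfolding \<phi>_def using that e
    by (auto intro!: derivative_eq_intros simp: algebra_simps)
  from laplacian_radial[where \<phi> = \<phi>, OF this, of 0 z]
  have eq: "laplacian (\<lambda>z. ((norm z)\<^sup>2 + e) powr (b / 2)) z =
    4 * (norm z)\<^sup>2 * \<phi> 2 ((norm z)\<^sup>2) + 2 * ?d * \<phi> 1 ((norm z)\<^sup>2)"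
    by (simp add: \<phi>_def)
  define q where "q = (norm z)\<^sup>2 + e"
  have q: "q > 0" "q \<le> M" using e z by (auto simp: q_def add_nonneg_pos)
  have p: "q powr (b / 2 - 1) = q * q powr (b / 2 - 2)"
    using q by (subst powr_mult_base) auto
  have "laplacian (\<lambda>z. ((norm z)\<^sup>2 + e) powr (b / 2)) z =
      b * q powr (b / 2 - 2) * ((b - 2) * (norm z)\<^sup>2 + ?d * q)"
    unfolding eq \<phi>_def q_def[symmetric] using p
    by (simp add: numeral_2_eq_2 algebra_simps)
  also have "\<dots> \<le> b * q powr (b / 2 - 2) * ((b + ?d - 2) * q)"
  proof (rule mult_left_mono_neg)
    have "(b - 2) * q \<le> (b - 2) * (norm z)\<^sup>2"
      using b e by (intro mult_left_mono_neg) (auto simp: q_def)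
    then show "(b + ?d - 2) * q \<le> (b - 2) * (norm z)\<^sup>2 + ?d * q" by (simp add: algebra_simps)
    show "b * q powr (b / 2 - 2) \<le> 0" using b by (simp add: mult_nonpos_nonneg)
  qed
  also have "\<dots> = b * (b + ?d - 2) * q powr (b / 2 - 1)" using p by simp
  also have "\<dots> \<le> b * (b + ?d - 2) * M powr (b / 2 - 1)"
    using b q by (intro mult_left_mono_neg powr_mono2') (auto intro!: mult_nonpos_nonneg)
  finally show ?thesis .
qed

lemma smooth_reg_powr: "e > 0 \<Longrightarrow> smooth (\<lambda>z::'a::euclidean_space. ((norm z)\<^sup>2 + e) powr p)"
proof -
  assume e: "e > 0"
  define \<phi> where "\<phi> = (\<lambda>j t. (\<Prod>i<j. p - real i) * (t + e) powr (p - real j))"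
  have "(\<phi> j has_real_derivative \<phi> (Suc j) t) (at t)" if "t \<in> {0..}" for j t
    unfolding \<phi>_def using that e
    by (auto intro!: derivative_eq_intros simp: algebra_simps)
  then have "smooth (\<lambda>z::'a. \<phi> 0 ((norm (z - 0))\<^sup>2))"
    by (rule smooth_compose_derivative_sequence[where S = "{0..}", OF smooth_norm_sq, rotated]) auto
  then show ?thesis by (simp add: \<phi>_def)
qed

text \<open>A quantitative form of superharmonicity that never differentiates the singular kernel: Green's
identity moves the Laplacian onto the regularized power, where the uniform negative bound holds, and
the regularization is then removed by dominated convergence. Only the points \<open>z\<close> within distance
one of \<open>x\<close> contribute, so \<open>norm z \<le> 3\<close>, and \<open>10\<close> bounds \<open>(norm z)\<^sup>2 + e\<close> for \<open>e \<le> 1\<close>.\<close>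

theorem riesz_superharmonic:
  fixes x :: "'a::euclidean_space"
  assumes b: "b < 0" "2 - real DIM('a) < b" and x: "norm x \<le> 2"
  shows "(\<integral>z. norm z powr b * laplacian (bump 1) (x - z) \<partial>lborel) \<le>
    b * (b + real DIM('a) - 2) * 10 powr (b / 2 - 1) * (\<integral>z. bump 1 (z::'a) \<partial>lborel)"
proof -
  let ?h = "\<lambda>z. bump 1 (z - x)" and ?C = "b * (b + real DIM('a) - 2) * 10 powr (b / 2 - 1)"
  let ?w = "\<lambda>e z. ((norm z)\<^sup>2 + e) powr (b / 2)"
  let ?I = "\<integral>z. bump 1 (z::'a) \<partial>lborel"
  have sh: "smooth ?h" by (rule smooth_bump)
  note sm0 = smooth_bump[of 1 "0::'a", simplified]
  note [measurable] = smooth_measurable[OF sm0] smooth_measurable[OF sh]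
    smooth_measurable[OF smooth_laplacian[OF sh]] smooth_measurable[OF smooth_laplacian[OF sm0]]
  have supp0: "bump 1 y = 0" if "norm y > 1" for y :: 'a
    using bump_support[of 1 y] that by simp
  have supp: "?h z = 0" if "norm z > norm x + 1" for z
    by (rule supp0) (use that norm_triangle_ineq2[of z x] in linarith)
  have lap: "laplacian (bump 1) (x - z) = laplacian ?h z" for z
    using laplacian_bump[of 1 0 "x - z"] by (simp add: laplacian_bump norm_minus_commute)
  have hI: "(\<integral>z. ?h z \<partial>lborel) = ?I"
  proof -
    have "?h z = bump 1 (x - z)" for z by (simp add: bump_def norm_minus_commute)
    then show ?thesis using lborel_integral_reflect[of "bump 1" x] by simp
  qed
  have bound: "(\<integral>z. ?w e z * laplacian ?h z \<partial>lborel) \<le> ?C * ?I" if e: "0 < e" "e \<le> 1" for e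
  proof -
    have sw: "smooth (?w e :: 'a \<Rightarrow> real)" by (rule smooth_reg_powr[OF e(1)])
    have "(\<integral>z. ?w e z * laplacian ?h z \<partial>lborel) = (\<integral>z. laplacian (?w e) z * ?h z \<partial>lborel)"
      by (rule Green_second_identity[OF sw sh supp])
    also have "\<dots> \<le> (\<integral>z. ?C * ?h z \<partial>lborel)"
    proof (rule integral_mono)
      show "integrable lborel (\<lambda>z. laplacian (?w e) z * ?h z)"
        by (rule integrable_mult_compact_support[OF smooth_continuous_on smooth_continuous_on,
              OF smooth_laplacian[OF sw] sh supp])
      show "integrable lborel (\<lambda>z. ?C * ?h z)"
        by (rule integrable_mult_compact_support[OF continuous_on_const smooth_continuous_on,
              OF sh supp])
      fix z
      show "laplacian (?w e) z * ?h z \<le> ?C * ?h z"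
      proof (cases "norm (z - x) \<le> 1")
        case True
        then have "norm z \<le> 3" using x norm_triangle_ineq2[of z x] by linarith
        then have "(norm z)\<^sup>2 + e \<le> 10" using power_mono[of "norm z" 3 2] e by simp
        then show ?thesis
          by (intro mult_right_mono laplacian_reg_powr_le b e bump_nonneg)
      next
        case False
        then show ?thesis by (simp add: supp0)
      qed
    qed
    finally show ?thesis by (simp add: hI)
  qed
  have "(\<lambda>n. \<integral>z. ?w (1 / real (Suc n)) z * laplacian ?h z \<partial>lborel) \<longlonglongrightarrow>
      (\<integral>z. norm z powr b * laplacian ?h z \<partial>lborel)"
  proof (rule integral_dominated_convergence)
    obtain B where B: "B \<ge> 0" "\<And>y. \<bar>laplacian (bump 1) (y::'a)\<bar> \<le> B"
      by (rule compact_support_bounded[of "laplacian (bump 1)" 1])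
        (use smooth_continuous_on[OF smooth_laplacian[OF sm0]] support_laplacian[OF supp0] in auto)
    have "integrable lborel (\<lambda>z::'a. norm z powr b * laplacian (bump 1) (x - z))"
      by (rule integrable_convolution[OF locally_integrable_norm_powr _ B(2), where R = 1])
        (use b support_laplacian[OF supp0] in auto)
    then show "integrable lborel (\<lambda>z. \<bar>norm z powr b * laplacian ?h z\<bar>)"
      by (simp add: lap)
    have "((\<lambda>n. ?w (1 / real (Suc n)) z * laplacian ?h z) \<longlonglongrightarrow> norm z powr b * laplacian ?h z)"
      if "z \<noteq> 0" for z
    proof -
      have "(\<lambda>n. ((norm z)\<^sup>2 + 1 / real (Suc n)) powr (b / 2)) \<longlonglongrightarrow> ((norm z)\<^sup>2 + 0) powr (b / 2)"
        by (intro tendsto_intros lim_1_over_n[THEN LIMSEQ_Suc]) (use that in auto)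
      moreover have "((norm z)\<^sup>2 + 0) powr (b / 2) = norm z powr b"
        using that by (simp add: powr_powr flip: powr_numeral)
      ultimately show ?thesis by (intro tendsto_mult tendsto_const) simp
    qed
    then show "AE z in lborel. (\<lambda>n. ?w (1 / real (Suc n)) z * laplacian ?h z) \<longlonglongrightarrow> norm z powr b * laplacian ?h z"
      using AE_lborel_singleton[of "0::'a"] by (auto elim: eventually_mono)
    have "norm (?w (1 / real (Suc n)) z * laplacian ?h z) \<le> \<bar>norm z powr b * laplacian ?h z\<bar>"
      if "z \<noteq> 0" for z n
    proof -
      have "?w (1 / real (Suc n)) z \<le> ((norm z)\<^sup>2) powr (b / 2)"
        using that b by (intro powr_mono2') auto
      also have "\<dots> = norm z powr b"
        using that by (simp add: powr_powr flip: powr_numeral)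
      finally show ?thesis by (auto simp: abs_mult intro!: mult_right_mono)
    qed
    then show "AE z in lborel. norm (?w (1 / real (Suc n)) z * laplacian ?h z) \<le> \<bar>norm z powr b * laplacian ?h z\<bar>" for n
      using AE_lborel_singleton[of "0::'a"] by (auto elim: eventually_mono)
  qed measurable
  then have "(\<integral>z. norm z powr b * laplacian ?h z \<partial>lborel) \<le> ?C * ?I"
    by (rule LIMSEQ_le_const2) (auto intro!: exI[of _ 0] bound)
  then show ?thesis by (simp add: lap)
qed

section \<open>Radial symmetry of convolutions\<close>

lemma nn_integral_translate:
  fixes f :: "'a::euclidean_space \<Rightarrow> ennreal"
  assumes [measurable]: "f \<in> borel_measurable borel"
  shows "(\<integral>\<^sup>+z. f (z + c) \<partial>lborel) = (\<integral>\<^sup>+z. f z \<partial>lborel)"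
  by (subst (2) lborel_distr_plus[symmetric, of c]) (simp add: nn_integral_distr add.commute)

definition gauss_mass :: "'a::euclidean_space itself \<Rightarrow> real \<Rightarrow> ennreal" where
  "gauss_mass _ t = (\<integral>\<^sup>+z. ennreal (exp (- t * (norm z)\<^sup>2)) \<partial>(lborel :: 'a measure))"

lemma gauss_mass_finite:
  assumes t: "t > 0"
  shows "gauss_mass TYPE('a::euclidean_space) t < \<infinity>"
proof -
  have "ennreal (exp (- t * (norm z)\<^sup>2)) = (\<Prod>i\<in>Basis. ennreal (exp (- t * (z \<bullet> i)\<^sup>2)))" for z :: 'a
  proof -
    have "(norm z)\<^sup>2 = (\<Sum>i\<in>Basis. (z \<bullet> i)\<^sup>2)"
      unfolding power2_norm_eq_inner by (subst euclidean_inner) (simp add: power2_eq_square)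
    then have "exp (- t * (norm z)\<^sup>2) = (\<Prod>i\<in>Basis. exp (- t * (z \<bullet> i)\<^sup>2))"
      by (simp only: sum_distrib_left exp_sum finite_Basis)
    then show ?thesis by (simp add: prod_ennreal)
  qed
  then have "gauss_mass TYPE('a) t = (\<Prod>i\<in>(Basis::'a set). \<integral>\<^sup>+x. ennreal (exp (- t * x\<^sup>2)) \<partial>lborel)"
    unfolding gauss_mass_def
    using nn_integral_lborel_prod[of "\<lambda>(_::'a) x. ennreal (exp (- t * x\<^sup>2))"] by simp
  moreover have "(\<integral>\<^sup>+x. ennreal (exp (- t * x\<^sup>2)) \<partial>lborel) < \<infinity>"
  proof -
    define \<sigma> where "\<sigma> = 1 / sqrt (2 * t)"
    have \<sigma>: "\<sigma> > 0" "\<sigma>\<^sup>2 = 1 / (2 * t)" using t by (simp_all add: \<sigma>_def power_divide)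
    have "exp (- t * x\<^sup>2) = sqrt (2 * pi * \<sigma>\<^sup>2) * normal_density 0 \<sigma> x" for x
      using \<sigma> t by (simp add: normal_density_def field_simps)
    then have "integrable lborel (\<lambda>x. exp (- t * x\<^sup>2))"
      using integrable_normal_moment[OF \<sigma>(1), of 0 0] by simp
    then show ?thesis by (simp add: integrable_iff_bounded)
  qed
  ultimately show ?thesis by (simp add: power_less_top_ennreal)
qed

lemma gauss_mass_pos: "gauss_mass TYPE('a::euclidean_space) t \<noteq> 0"
proof
  assume "gauss_mass TYPE('a) t = 0"
  then have "AE z::'a in lborel. ennreal (exp (- t * (norm z)\<^sup>2)) = 0"
    unfolding gauss_mass_def by (subst (asm) nn_integral_0_iff_AE) auto
  then have "AE z::'a in lborel. z \<notin> UNIV" by simp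
  then have "(UNIV :: 'a set) \<in> null_sets lborel" by (subst AE_iff_null_sets) auto
  then show False by auto
qed

text \<open>The classical uniqueness argument for translation invariant measures, with a Gaussian as the
auxiliary weight. The weight is invariant under \<open>T\<close>, so exchanging integrals and translating twice
shows that both sides agree after multiplication by the finite positive mass of the Gaussian.\<close>

lemma nn_integral_isometric_involution:
  fixes T :: "'a::euclidean_space \<Rightarrow> 'a" and f :: "'a \<Rightarrow> ennreal"
  assumes T: "linear T" "\<And>x. T (T x) = x" "\<And>x. norm (T x) = norm x"
    and f[measurable]: "f \<in> borel_measurable borel"
  shows "(\<integral>\<^sup>+x. f (T x) \<partial>lborel) = (\<integral>\<^sup>+x. f x \<partial>lborel)"
proof -
  have [measurable]: "T \<in> borel_measurable borel"
    by (intro borel_measurable_continuous_onI linear_continuous_on)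
      (use T linear_conv_bounded_linear in blast)
  define g :: "'a \<Rightarrow> ennreal" where "g x = ennreal (exp (- 1 * (norm x)\<^sup>2))" for x
  have [measurable]: "g \<in> borel_measurable borel" unfolding g_def by measurable
  let ?c = "gauss_mass TYPE('a) 1"
  have c: "?c = (\<integral>\<^sup>+x. g x \<partial>lborel)" by (simp add: gauss_mass_def g_def)
  have "?c * (\<integral>\<^sup>+x. f (T x) \<partial>lborel) = (\<integral>\<^sup>+x. (\<integral>\<^sup>+y. f (T x) * g y \<partial>lborel) \<partial>lborel)"
    by (simp add: nn_integral_cmult nn_integral_multc c mult.commute)
  also have "\<dots> = (\<integral>\<^sup>+x. (\<integral>\<^sup>+y. f (T x) * g (T x - y) \<partial>lborel) \<partial>lborel)"
    by (intro nn_integral_cong nn_integral_reflect[symmetric]) measurable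
  also have "\<dots> = (\<integral>\<^sup>+y. (\<integral>\<^sup>+x. f (T x) * g (T x - y) \<partial>lborel) \<partial>lborel)"
    by (rule lborel_pair.Fubini') measurable
  also have "\<dots> = (\<integral>\<^sup>+y. (\<integral>\<^sup>+x. f (T x + y) * g x \<partial>lborel) \<partial>lborel)"
  proof (rule nn_integral_cong)
    fix y
    have "g (T x - y) = g (x - T y)" for x
    proof -
      have "T x - y = T (x - T y)" by (simp add: linear_diff[OF T(1)] T(2))
      then show ?thesis by (simp add: g_def T(3))
    qed
    then have "(\<integral>\<^sup>+x. f (T x) * g (T x - y) \<partial>lborel) = (\<integral>\<^sup>+x. f (T x) * g (x - T y) \<partial>lborel)" by simp
    also have "\<dots> = (\<integral>\<^sup>+x. f (T (x + T y)) * g (x + T y - T y) \<partial>lborel)"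
      by (rule nn_integral_translate[symmetric]) measurable
    finally show "(\<integral>\<^sup>+x. f (T x) * g (T x - y) \<partial>lborel) = (\<integral>\<^sup>+x. f (T x + y) * g x \<partial>lborel)"
      by (simp add: linear_add[OF T(1)] T(2))
  qed
  also have "\<dots> = (\<integral>\<^sup>+x. (\<integral>\<^sup>+y. f (T x + y) * g x \<partial>lborel) \<partial>lborel)"
    by (rule lborel_pair.Fubini') measurable
  also have "\<dots> = (\<integral>\<^sup>+x. (\<integral>\<^sup>+y. f y \<partial>lborel) * g x \<partial>lborel)"
  proof (intro nn_integral_cong)
    fix x
    have "(\<integral>\<^sup>+y. f (T x + y) * g x \<partial>lborel) = (\<integral>\<^sup>+y. f (y + T x) \<partial>lborel) * g x"
      by (simp add: nn_integral_multc add.commute)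
    then show "(\<integral>\<^sup>+y. f (T x + y) * g x \<partial>lborel) = (\<integral>\<^sup>+y. f y \<partial>lborel) * g x"
      by (simp add: nn_integral_translate)
  qed
  also have "\<dots> = ?c * (\<integral>\<^sup>+x. f x \<partial>lborel)"
    by (subst nn_integral_cmult) (simp_all add: c mult.commute)
  finally show ?thesis
    using gauss_mass_finite[of 1, where 'a='a] gauss_mass_pos[of 1, where 'a='a]
    by (auto simp: ennreal_mult_cancel_left)
qed

text \<open>Reflection in the hyperplane orthogonal to \<open>x - y\<close>.\<close>

lemma obtain_reflection:
  fixes x y :: "'a::euclidean_space"
  assumes xy: "norm x = norm y"
  obtains T where "linear T" "\<And>z. T (T z) = z" "\<And>z::'a. norm (T z) = norm z" "T x = y"
proof (cases "x = y")
  case True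
  then show ?thesis using that[of "\<lambda>z. z"] by (auto simp: linear_id[unfolded id_def])
next
  case False
  define u where "u = x - y"
  define T where "T z = z - (2 * (z \<bullet> u) / (u \<bullet> u)) *\<^sub>R u" for z
  have u: "u \<bullet> u \<noteq> 0" using False by (simp add: u_def)
  have "linear T"
    by (rule linearI) (simp_all add: T_def inner_add_left algebra_simps add_divide_distrib)
  moreover have Tu: "T z \<bullet> u = - (z \<bullet> u)" for z
    using u by (simp add: T_def inner_diff_left)
  then have "T (T z) = z" for z
    by (simp add: T_def[of "T z"]) (simp add: T_def)
  moreover have "norm (T z) = norm z" for z
  proof -
    have "T z \<bullet> T z = T z \<bullet> z - (2 * (z \<bullet> u) / (u \<bullet> u)) * (T z \<bullet> u)"
      by (subst (2) T_def) (simp add: inner_diff_right)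
    also have "\<dots> = z \<bullet> z"
      unfolding Tu by (simp add: T_def inner_diff_left inner_diff_right inner_commute)
    finally show ?thesis by (simp add: norm_eq)
  qed
  moreover have "T x = y"
  proof -
    have "x \<bullet> x = y \<bullet> y" using xy by (simp add: norm_eq)
    then have "2 * (x \<bullet> u) = u \<bullet> u"
      by (simp add: u_def inner_diff_left inner_diff_right inner_commute)
    then show ?thesis using u by (simp add: T_def) (simp add: u_def)
  qed
  ultimately show ?thesis by (rule that)
qed

theorem convolution_radial:
  fixes k f :: "'a::euclidean_space \<Rightarrow> ennreal"
  assumes k: "\<And>x y. norm x = norm y \<Longrightarrow> k x = k y" and f: "\<And>x y. norm x = norm y \<Longrightarrow> f x = f y"
    and [measurable]: "k \<in> borel_measurable borel" "f \<in> borel_measurable borel"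
    and xy: "norm x = norm y"
  shows "(\<integral>\<^sup>+z. k z * f (x - z) \<partial>lborel) = (\<integral>\<^sup>+z. k z * f (y - z) \<partial>lborel)"
proof -
  obtain T where T: "linear T" "\<And>z. T (T z) = z" "\<And>z. norm (T z) = norm z" "T x = y"
    by (rule obtain_reflection[OF xy]) blast
  have "(\<integral>\<^sup>+z. k z * f (y - z) \<partial>lborel) = (\<integral>\<^sup>+z. k (T z) * f (y - T z) \<partial>lborel)"
    by (rule nn_integral_isometric_involution[OF T(1-3), symmetric]) measurable
  also have "\<dots> = (\<integral>\<^sup>+z. k z * f (x - z) \<partial>lborel)"
  proof (intro nn_integral_cong arg_cong2[where f="(*)"])
    fix z
    show "k (T z) = k z" by (rule k) (rule T)
    have "y - T z = T (x - z)" by (simp add: linear_diff[OF T(1)] T(4))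
    then show "f (y - T z) = f (x - z)" by (intro f) (simp add: T(3))
  qed
  finally show ?thesis ..
qed

section \<open>The power potential as a superposition of Gaussians\<close>

definition riesz_kernel :: "real \<Rightarrow> 'a::euclidean_space \<Rightarrow> ennreal" where
  "riesz_kernel b z = (if z = 0 then \<infinity> else ennreal (norm z powr b / - b))"

lemma riesz_kernel_measurable [measurable]: "riesz_kernel b \<in> borel_measurable borel"
  unfolding riesz_kernel_def[abs_def] by measurable

text \<open>Euler's integral after the substitution \<open>s = t r\<^sup>2\<close>. It writes a negative power of \<open>r\<close> as a mixture of
the Gaussians \<open>exp (- t r\<^sup>2)\<close>.\<close>

lemma gamma_integral_scaled:
  fixes a r :: real
  assumes a: "a > 0" and r: "r > 0"
  shows "(\<integral>\<^sup>+t. ennreal (indicator {0<..} t * (t powr (a - 1) * exp (- t * r\<^sup>2))) \<partial>lborel) =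
    ennreal (Gamma a * r powr (- 2 * a))"
proof -
  let ?h = "\<lambda>t. ennreal (indicator {0..} t * t powr (a - 1) / exp t)"
  let ?I = "\<integral>\<^sup>+t. ennreal (indicator {0<..} t * (t powr (a - 1) * exp (- t * r\<^sup>2))) \<partial>lborel"
  have r2: "r\<^sup>2 > 0" using r by simp
  have "ennreal (Gamma a) = (\<integral>\<^sup>+t. ?h t \<partial>lborel)" by (rule Gamma_conv_nn_integral_real[OF a])
  also have "\<dots> = ennreal \<bar>r\<^sup>2\<bar> * (\<integral>\<^sup>+t. ?h (0 + r\<^sup>2 * t) \<partial>lborel)"
    by (rule nn_integral_real_affine) (use r in auto)
  also have "(\<integral>\<^sup>+t. ?h (0 + r\<^sup>2 * t) \<partial>lborel) =
      (\<integral>\<^sup>+t. ennreal (r\<^sup>2 powr (a - 1)) * ennreal (indicator {0<..} t * (t powr (a - 1) * exp (- t * r\<^sup>2))) \<partial>lborel)"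
  proof (rule nn_integral_cong)
    fix t
    show "?h (0 + r\<^sup>2 * t) = ennreal (r\<^sup>2 powr (a - 1)) * ennreal (indicator {0<..} t * (t powr (a - 1) * exp (- t * r\<^sup>2)))"
      using r2 by (cases "t > 0")
        (auto simp: indicator_def zero_le_mult_iff powr_mult exp_minus field_simps simp flip: ennreal_mult')
  qed
  also have "\<dots> = ennreal (r\<^sup>2 powr (a - 1)) * ?I"
    by (rule nn_integral_cmult) measurable
  finally have "ennreal (Gamma a) = ennreal (r powr (2 * a)) * ?I"
  proof -
    have "r\<^sup>2 * r\<^sup>2 powr (a - 1) = r\<^sup>2 powr a"
      using r2 powr_mult_base[of "r\<^sup>2" "a - 1"] by simp
    also have "\<dots> = r powr (2 * a)"
      using r by (simp add: powr_powr flip: powr_numeral)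
    finally have "r\<^sup>2 * r\<^sup>2 powr (a - 1) = r powr (2 * a)" .
    then show ?thesis if "ennreal (Gamma a) = ennreal \<bar>r\<^sup>2\<bar> * (ennreal (r\<^sup>2 powr (a - 1)) * ?I)"
      using that by (simp flip: mult.assoc ennreal_mult')
  qed
  then have "ennreal (r powr (- 2 * a)) * ennreal (Gamma a) =
      ennreal (r powr (- 2 * a) * r powr (2 * a)) * ?I"
    by (simp only: mult.assoc ennreal_mult' powr_ge_zero)
  moreover have "r powr (- 2 * a) * r powr (2 * a) = 1"
    using r by (simp only: powr_add[symmetric]) simp
  moreover have "ennreal (r powr (- 2 * a)) * ennreal (Gamma a) = ennreal (Gamma a * r powr (- 2 * a))"
    by (subst ennreal_mult'[symmetric]) (simp_all only: powr_ge_zero mult.commute)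
  ultimately show ?thesis by (simp only: ennreal_1 mult_1)
qed


text \<open>The index consists of a centre and an inverse squared width. The absolute value only serves to keep
the function bounded for all indices; those with negative second component carry no weight.\<close>

definition feature :: "'a::euclidean_space \<times> real \<Rightarrow> 'a \<Rightarrow> real" where
  "feature p x = exp (- (2 * \<bar>snd p\<bar> * (norm (x - fst p))\<^sup>2))"

text \<open>The power of the width comes from Euler's integral for the exponent \<open>- b / 2\<close>; dividing by the mass
of the Gaussian normalizes the convolution of two features with the same width.\<close>

definition feature_weight :: "real \<Rightarrow> 'a::euclidean_space \<times> real \<Rightarrow> ennreal" where
  "feature_weight b p = (if snd p > 0 then
     ennreal (snd p powr (- b / 2 - 1) / (Gamma (- b / 2) * - b)) / gauss_mass TYPE('a) (4 * snd p) else 0)"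

lemma feature_measurable [measurable (raw)]:
  fixes f :: "'b \<Rightarrow> 'a::euclidean_space \<times> real"
  assumes "f \<in> borel_measurable M" "g \<in> borel_measurable M"
  shows "(\<lambda>w. feature (f w) (g w)) \<in> borel_measurable M"
  by (rule borel_measurable_continuous_Pair[OF assms])
    (unfold feature_def, intro continuous_intros)

lemma gauss_mass_measurable [measurable]: "gauss_mass TYPE('a::euclidean_space) \<in> borel_measurable borel"
  unfolding gauss_mass_def by measurable

lemma feature_weight_measurable [measurable]: "feature_weight b \<in> borel_measurable borel"
  unfolding feature_weight_def[abs_def] borel_prod[symmetric] by measurable

text \<open>By the parallelogram law around the midpoint \<open>m\<close> of \<open>x\<close> and \<open>y\<close>, the product of the two Gaussians in
\<open>z\<close> is a Gaussian centred at \<open>m\<close> times a factor depending on \<open>x - y\<close> only.\<close>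

lemma integral_feature_product:
  fixes x y :: "'a::euclidean_space"
  assumes "t > 0"
  shows "(\<integral>\<^sup>+z. ennreal (feature (z, t) x * feature (z, t) y) \<partial>lborel) =
    ennreal (exp (- (t * (norm (x - y))\<^sup>2))) * gauss_mass TYPE('a) (4 * t)"
proof -
  define m where "m = (1/2) *\<^sub>R (x + y)"
  have "(norm (x - z))\<^sup>2 + (norm (y - z))\<^sup>2 = 2 * (norm (m - z))\<^sup>2 + (norm (x - y))\<^sup>2 / 2" for z
    unfolding power2_norm_eq_inner m_def
    by (simp add: inner_diff_left inner_diff_right inner_add_left inner_add_right inner_commute field_simps)
  then have "2 * t * ((norm (x - z))\<^sup>2 + (norm (y - z))\<^sup>2) =
      2 * t * (2 * (norm (m - z))\<^sup>2 + (norm (x - y))\<^sup>2 / 2)" for z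
    by simp
  then have "feature (z, t) x * feature (z, t) y =
      exp (- (t * (norm (x - y))\<^sup>2)) * exp (- (4 * t) * (norm (m - z))\<^sup>2)" for z
    unfolding feature_def exp_add[symmetric] using assms by (simp add: algebra_simps)
  then have "(\<integral>\<^sup>+z. ennreal (feature (z, t) x * feature (z, t) y) \<partial>lborel) =
      (\<integral>\<^sup>+z. ennreal (exp (- (t * (norm (x - y))\<^sup>2))) * ennreal (exp (- (4 * t) * (norm (m - z))\<^sup>2)) \<partial>lborel)"
    by (simp add: ennreal_mult)
  also have "\<dots> = ennreal (exp (- (t * (norm (x - y))\<^sup>2))) *
      (\<integral>\<^sup>+z. ennreal (exp (- (4 * t) * (norm (m - z))\<^sup>2)) \<partial>lborel)"
    by (rule nn_integral_cmult) measurable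
  also have "(\<integral>\<^sup>+z. ennreal (exp (- (4 * t) * (norm (m - z))\<^sup>2)) \<partial>lborel) = gauss_mass TYPE('a) (4 * t)"
    unfolding gauss_mass_def
    by (rule nn_integral_reflect[of "\<lambda>z. ennreal (exp (- (4 * t) * (norm z)\<^sup>2))" m]) measurable
  finally show ?thesis .
qed

text \<open>Integrating out the centre gives \<open>exp (- t (norm (x - y))\<^sup>2)\<close>, and integrating out \<open>t\<close> gives the power by
Euler's integral. The identity also holds on the diagonal, where both sides are infinite: the right
side dominates the value at every positive distance.\<close>

theorem riesz_kernel_eq_features:
  fixes x y :: "'a::euclidean_space"
  assumes b: "b < 0"
  shows "riesz_kernel b (x - y) =
    (\<integral>\<^sup>+p. feature_weight b p * ennreal (feature p x * feature p y) \<partial>lborel)"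
proof -
  let ?a = "- b / 2" and ?G = "gauss_mass TYPE('a)"
  define c where "c = Gamma ?a * - b"
  have G: "Gamma ?a > 0" using b by (intro Gamma_real_pos) simp
  have c: "c > 0" unfolding c_def using b G by (intro mult_pos_pos) auto
  define J where "J r = (\<integral>\<^sup>+t. ennreal (indicator {0<..} t * (t powr (?a - 1) * exp (- t * r\<^sup>2))) \<partial>lborel)" for r
  let ?F = "\<lambda>p. feature_weight b p * ennreal (feature p x * feature p y)"
  have "(\<integral>\<^sup>+p. ?F p \<partial>lborel) = (\<integral>\<^sup>+t. (\<integral>\<^sup>+z. ?F (z, t) \<partial>lborel) \<partial>lborel)"
    unfolding lborel_prod[symmetric] by (rule lborel_pair.nn_integral_snd[symmetric]) (unfold lborel_prod, measurable)
  also have "\<dots> = (\<integral>\<^sup>+t. ennreal (1 / c) * ennreal (indicator {0<..} t * (t powr (?a - 1) * exp (- t * (norm (x - y))\<^sup>2))) \<partial>lborel)"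
  proof (rule nn_integral_cong)
    fix t :: real
    show "(\<integral>\<^sup>+z. ?F (z, t) \<partial>lborel) =
      ennreal (1 / c) * ennreal (indicator {0<..} t * (t powr (?a - 1) * exp (- t * (norm (x - y))\<^sup>2)))"
    proof (cases "t > 0")
      case True
      have g: "?G (4 * t) \<noteq> 0" "?G (4 * t) < \<infinity>"
        using gauss_mass_pos gauss_mass_finite[of "4 * t", where 'a = 'a] True by auto
      have "(\<integral>\<^sup>+z. ?F (z, t) \<partial>lborel) =
          (\<integral>\<^sup>+z. (ennreal (t powr (?a - 1) / c) / ?G (4 * t)) * ennreal (feature (z, t) x * feature (z, t) y) \<partial>lborel)"
        using True by (simp add: feature_weight_def c_def)
      also have "\<dots> = (ennreal (t powr (?a - 1) / c) / ?G (4 * t)) *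
          (ennreal (exp (- (t * (norm (x - y))\<^sup>2))) * ?G (4 * t))"
        by (subst nn_integral_cmult) (simp_all add: integral_feature_product True)
      also have "\<dots> = ennreal (t powr (?a - 1) / c) * ennreal (exp (- (t * (norm (x - y))\<^sup>2)))"
        using g by (simp add: ennreal_divide_times mult_divide_eq_ennreal ennreal_times_divide)
      also have "\<dots> = ennreal (1 / c) * ennreal (t powr (?a - 1) * exp (- t * (norm (x - y))\<^sup>2))"
        using c by (simp flip: ennreal_mult)
      finally show ?thesis using True by simp
    next
      case False
      then show ?thesis by (simp add: feature_weight_def)
    qed
  qed
  also have "\<dots> = ennreal (1 / c) * J (norm (x - y))"
    unfolding J_def by (rule nn_integral_cmult) measurable
  also have "\<dots> = riesz_kernel b (x - y)"
  proof (cases "x = y")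
    case False
    then have "J (norm (x - y)) = ennreal (Gamma ?a * norm (x - y) powr (- 2 * ?a))"
      unfolding J_def using b by (intro gamma_integral_scaled) auto
    then show ?thesis
      using False c less_imp_neq[OF G] b by (simp add: riesz_kernel_def c_def ennreal_mult'[symmetric] field_simps)
  next
    case True
    have le: "ennreal (Gamma ?a * r powr (- 2 * ?a)) \<le> J 0" if "r > 0" for r
    proof -
      have "ennreal (Gamma ?a * r powr (- 2 * ?a)) = J r"
        unfolding J_def using b that by (intro gamma_integral_scaled[symmetric]) auto
      also have "J r \<le> J 0"
        unfolding J_def by (intro nn_integral_mono ennreal_leI) (auto simp: indicator_def intro!: mult_left_le)
      finally show ?thesis .
    qed
    have "J 0 = \<infinity>"
    proof (rule ccontr)
      assume "J 0 \<noteq> \<infinity>"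
      then obtain M where M: "J 0 = ennreal M" "M \<ge> 0" by (cases "J 0") auto
      define r where "r = ((M + 1) / Gamma ?a) powr (1 / b)"
      have "r > 0" using M less_imp_neq[OF G] by (simp add: r_def)
      moreover have "Gamma ?a * r powr (- 2 * ?a) = M + 1"
        using M less_imp_neq[OF G] divide_nonneg_pos[OF _ G, of "M + 1"] b by (simp add: r_def powr_powr)
      ultimately have "ennreal (M + 1) \<le> ennreal M" using le[of r] M by simp
      then show False using M by (subst (asm) ennreal_le_iff) auto
    qed
    then show ?thesis using True c by (simp add: riesz_kernel_def ennreal_mult_top)
  qed
  finally show ?thesis ..
qed

section \<open>Strict positive definiteness of the interaction energy\<close>

definition mutual_energy :: "real \<Rightarrow> 'a::euclidean_space measure \<Rightarrow> 'a measure \<Rightarrow> ennreal" where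
  "mutual_energy b \<rho> \<sigma> = (\<integral>\<^sup>+x. (\<integral>\<^sup>+y. riesz_kernel b (x - y) \<partial>\<sigma>) \<partial>\<rho>)"

definition feature_integral :: "'a::euclidean_space measure \<Rightarrow> 'a \<times> real \<Rightarrow> real" where
  "feature_integral \<rho> p = (\<integral>x. feature p x \<partial>\<rho>)"

lemma feature_bounds: "0 \<le> feature p x" "feature p x \<le> 1"
  by (simp_all add: feature_def)

lemma feature_integrable:
  assumes "finite_measure \<rho>" and s[measurable_cong]: "sets \<rho> = sets borel"
  shows "integrable \<rho> (feature p)"
proof -
  interpret finite_measure \<rho> by fact
  show ?thesis
    by (rule integrable_const_bound[where B = 1]) (use feature_bounds[of p] in auto)
qed

lemma nn_integral_feature:
  assumes "finite_measure \<rho>" "sets \<rho> = sets borel"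
  shows "(\<integral>\<^sup>+x. ennreal (feature p x) \<partial>\<rho>) = ennreal (feature_integral \<rho> p)"
  unfolding feature_integral_def
  by (rule nn_integral_eq_integral[OF feature_integrable[OF assms]]) (simp add: feature_bounds)

lemma feature_integral_nonneg: "0 \<le> feature_integral \<rho> p"
  unfolding feature_integral_def by (simp add: feature_bounds)

lemma feature_integral_measurable [measurable]:
  fixes \<rho> :: "'a::euclidean_space measure"
  assumes "finite_measure \<rho>" and s[measurable_cong]: "sets \<rho> = sets borel"
  shows "feature_integral \<rho> \<in> borel_measurable borel"
proof -
  interpret finite_measure \<rho> by fact
  show ?thesis unfolding feature_integral_def[abs_def] by measurable
qed

lemma mutual_energy_eq_features:
  fixes \<rho> \<sigma> :: "'a::euclidean_space measure"
  assumes b: "b < 0"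
    and \<rho>: "finite_measure \<rho>" and s\<rho>[measurable_cong]: "sets \<rho> = sets borel"
    and \<sigma>: "finite_measure \<sigma>" and s\<sigma>[measurable_cong]: "sets \<sigma> = sets borel"
  shows "mutual_energy b \<rho> \<sigma> =
    (\<integral>\<^sup>+p. feature_weight b p * ennreal (feature_integral \<rho> p * feature_integral \<sigma> p) \<partial>lborel)"
proof -
  interpret R: finite_measure \<rho> by fact
  interpret S: finite_measure \<sigma> by fact
  interpret RL: pair_sigma_finite "lborel :: ('a \<times> real) measure" \<rho> ..
  interpret SL: pair_sigma_finite "lborel :: ('a \<times> real) measure" \<sigma> ..
  note [measurable] = feature_integral_measurable[OF \<sigma> s\<sigma>] feature_integral_measurable[OF \<rho> s\<rho>]
  have "mutual_energy b \<rho> \<sigma> = (\<integral>\<^sup>+x. (\<integral>\<^sup>+y. (\<integral>\<^sup>+p. feature_weight b p * ennreal (feature p x * feature p y) \<partial>lborel) \<partial>\<sigma>) \<partial>\<rho>)"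
    unfolding mutual_energy_def riesz_kernel_eq_features[OF b] ..
  also have "\<dots> = (\<integral>\<^sup>+x. (\<integral>\<^sup>+p. (\<integral>\<^sup>+y. feature_weight b p * ennreal (feature p x * feature p y) \<partial>\<sigma>) \<partial>lborel) \<partial>\<rho>)"
    by (rule nn_integral_cong, rule SL.Fubini') measurable
  also have "\<dots> = (\<integral>\<^sup>+x. (\<integral>\<^sup>+p. feature_weight b p * ennreal (feature p x * feature_integral \<sigma> p) \<partial>lborel) \<partial>\<rho>)"
  proof (intro nn_integral_cong)
    fix x p
    have "(\<integral>\<^sup>+y. feature_weight b p * ennreal (feature p x * feature p y) \<partial>\<sigma>) =
        (\<integral>\<^sup>+y. (feature_weight b p * ennreal (feature p x)) * ennreal (feature p y) \<partial>\<sigma>)"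
      by (simp add: ennreal_mult feature_bounds mult.assoc)
    also have "\<dots> = (feature_weight b p * ennreal (feature p x)) * ennreal (feature_integral \<sigma> p)"
      by (subst nn_integral_cmult) (simp_all add: nn_integral_feature[OF \<sigma> s\<sigma>])
    finally show "(\<integral>\<^sup>+y. feature_weight b p * ennreal (feature p x * feature p y) \<partial>\<sigma>) =
        feature_weight b p * ennreal (feature p x * feature_integral \<sigma> p)"
      by (simp add: ennreal_mult feature_bounds feature_integral_nonneg mult.assoc)
  qed
  also have "\<dots> = (\<integral>\<^sup>+p. (\<integral>\<^sup>+x. feature_weight b p * ennreal (feature p x * feature_integral \<sigma> p) \<partial>\<rho>) \<partial>lborel)"
    by (rule RL.Fubini') measurable
  also have "\<dots> = (\<integral>\<^sup>+p. feature_weight b p * ennreal (feature_integral \<rho> p * feature_integral \<sigma> p) \<partial>lborel)"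
  proof (intro nn_integral_cong)
    fix p
    have "(\<integral>\<^sup>+x. feature_weight b p * ennreal (feature p x * feature_integral \<sigma> p) \<partial>\<rho>) =
        (\<integral>\<^sup>+x. (feature_weight b p * ennreal (feature_integral \<sigma> p)) * ennreal (feature p x) \<partial>\<rho>)"
      by (simp add: ennreal_mult feature_bounds feature_integral_nonneg mult_ac)
    also have "\<dots> = (feature_weight b p * ennreal (feature_integral \<sigma> p)) * ennreal (feature_integral \<rho> p)"
      by (subst nn_integral_cmult) (simp_all add: nn_integral_feature[OF \<rho> s\<rho>])
    finally show "(\<integral>\<^sup>+x. feature_weight b p * ennreal (feature p x * feature_integral \<sigma> p) \<partial>\<rho>) =
        feature_weight b p * ennreal (feature_integral \<rho> p * feature_integral \<sigma> p)"
      by (simp add: ennreal_mult feature_integral_nonneg mult_ac)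
  qed
  finally show ?thesis .
qed

lemma feature_weight_pos: "b < 0 \<Longrightarrow> t > 0 \<Longrightarrow> feature_weight b (z::'a::euclidean_space, t) \<noteq> 0"
proof -
  assume b: "b < 0" and t: "t > 0"
  have "0 < Gamma (- b / 2) * - b"
    using b by (intro mult_pos_pos Gamma_real_pos) auto
  then have "0 < t powr (- b / 2 - 1) / (Gamma (- b / 2) * - b)"
    using t by (intro divide_pos_pos) auto
  then show ?thesis
    unfolding feature_weight_def snd_conv
    using t gauss_mass_finite[of "4 * t", where 'a='a]
    by (simp only: if_True ennreal_divide_eq_0_iff ennreal_eq_0_iff) auto
qed

lemma AE_lborel_ex:
  fixes S :: "'a::euclidean_space set"
  assumes "AE z in lborel. Q z" "open S" "S \<noteq> {}"
  obtains z where "z \<in> S" "Q z"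
proof -
  have "\<not> (\<forall>z\<in>S. \<not> Q z)"
  proof
    assume "\<forall>z\<in>S. \<not> Q z"
    with assms(1) have "AE z in lborel. z \<notin> S" by (auto elim: eventually_mono)
    then have "S \<in> null_sets lborel"
      using assms(2) by (subst AE_iff_null_sets) auto
    then have "negligible S" by (simp add: negligible_iff_null_sets null_sets_completionI)
    then show False using open_not_negligible assms(2,3) by blast
  qed
  then show ?thesis using that by blast
qed

text \<open>In terms of features the two sides differ by the integral \<open>D\<close> of the weighted squares of
\<open>\<integral>\<phi>\<^sub>p d\<rho> - \<integral>\<phi>\<^sub>p d\<nu>\<close>. If \<open>D\<close> were zero, then for some centre the two feature integrals would agree
along a sequence of widths tending to infinity, along which they converge to the total masses.
Comparing masses thus replaces the injectivity of the feature map.\<close>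

theorem mutual_energy_strict:
  fixes \<rho> \<nu> :: "'a::euclidean_space measure"
  assumes b: "b < 0"
    and \<rho>: "finite_measure \<rho>" and s\<rho>[measurable_cong]: "sets \<rho> = sets borel"
    and \<nu>: "finite_measure \<nu>" and s\<nu>[measurable_cong]: "sets \<nu> = sets borel"
    and fin: "mutual_energy b \<rho> \<rho> < \<infinity>" "mutual_energy b \<nu> \<nu> < \<infinity>"
    and ne: "measure \<rho> UNIV \<noteq> measure \<nu> UNIV"
  shows "2 * mutual_energy b \<rho> \<nu> < mutual_energy b \<rho> \<rho> + mutual_energy b \<nu> \<nu>"
proof -
  note [measurable] = feature_integral_measurable[OF \<nu> s\<nu>] feature_integral_measurable[OF \<rho> s\<rho>]
  define r where "r = feature_integral \<rho>"
  define n where "n = feature_integral \<nu>"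
  have [measurable]: "r \<in> borel_measurable borel" "n \<in> borel_measurable borel"
    unfolding r_def n_def by measurable
  have nn: "0 \<le> r p" "0 \<le> n p" for p by (simp_all add: r_def n_def feature_integral_nonneg)
  note E = mutual_energy_eq_features[OF b \<rho> s\<rho> \<rho> s\<rho>] mutual_energy_eq_features[OF b \<nu> s\<nu> \<nu> s\<nu>]
    mutual_energy_eq_features[OF b \<rho> s\<rho> \<nu> s\<nu>]
  define D where "D = (\<integral>\<^sup>+p. feature_weight b p * ennreal ((r p - n p)\<^sup>2) \<partial>lborel)"
  have "mutual_energy b \<rho> \<rho> + mutual_energy b \<nu> \<nu> =
      (\<integral>\<^sup>+p. feature_weight b p * ennreal (r p * r p) + feature_weight b p * ennreal (n p * n p) \<partial>lborel)"
    unfolding E r_def[symmetric] n_def[symmetric] by (rule nn_integral_add[symmetric]) measurable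
  also have "\<dots> = (\<integral>\<^sup>+p. 2 * (feature_weight b p * ennreal (r p * n p)) + feature_weight b p * ennreal ((r p - n p)\<^sup>2) \<partial>lborel)"
  proof (rule nn_integral_cong)
    fix p
    have "r p * r p + n p * n p = 2 * (r p * n p) + (r p - n p)\<^sup>2"
      by (simp add: power2_eq_square algebra_simps)
    then have "ennreal (r p * r p) + ennreal (n p * n p) = 2 * ennreal (r p * n p) + ennreal ((r p - n p)\<^sup>2)"
      using nn[of p] ennreal_mult'[of 2 "r p * n p"] ennreal_plus[of "2 * (r p * n p)" "(r p - n p)\<^sup>2"]
      by (simp flip: ennreal_plus)
    then show "feature_weight b p * ennreal (r p * r p) + feature_weight b p * ennreal (n p * n p) =
        2 * (feature_weight b p * ennreal (r p * n p)) + feature_weight b p * ennreal ((r p - n p)\<^sup>2)"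
      by (metis distrib_left mult.left_commute)
  qed
  also have "\<dots> = 2 * mutual_energy b \<rho> \<nu> + D"
    unfolding E D_def r_def[symmetric] n_def[symmetric]
    by (subst nn_integral_add) (simp_all add: nn_integral_cmult)
  finally have eq: "mutual_energy b \<rho> \<rho> + mutual_energy b \<nu> \<nu> = 2 * mutual_energy b \<rho> \<nu> + D" .
  have "D \<noteq> 0"
  proof
    assume "D = 0"
    then have "AE p in lborel. feature_weight b p * ennreal ((r p - n p)\<^sup>2) = 0"
      unfolding D_def by (subst (asm) nn_integral_0_iff_AE) measurable
    then have "AE p in lborel \<Otimes>\<^sub>M lborel. feature_weight b p * ennreal ((r p - n p)\<^sup>2) = 0"
      by (simp only: lborel_prod)
    then have "AE z in lborel. AE t in lborel. feature_weight b (z, t) * ennreal ((r (z, t) - n (z, t))\<^sup>2) = 0"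
      by (rule lborel_pair.AE_pair)
    then obtain z where
      z: "AE t in lborel. feature_weight b (z, t) * ennreal ((r (z, t) - n (z, t))\<^sup>2) = 0"
      by (rule AE_lborel_ex[where S = UNIV]) auto
    have "\<exists>t. 0 < t \<and> t < 1 / real (Suc k) \<and> r (z, t) = n (z, t)" for k
    proof -
      obtain t where "t \<in> {0<..<1 / real (Suc k)}" "feature_weight b (z, t) * ennreal ((r (z, t) - n (z, t))\<^sup>2) = 0"
        by (rule AE_lborel_ex[OF z, of "{0<..<1 / real (Suc k)}"]) auto
      then show ?thesis using feature_weight_pos[OF b, of t z] by auto
    qed
    then obtain t where t: "\<And>k. 0 < t k" "\<And>k. t k < 1 / real (Suc k)" "\<And>k. r (z, t k) = n (z, t k)"
      by metis
    have t0: "t \<longlonglongrightarrow> 0"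
      by (rule tendsto_sandwich[OF _ _ tendsto_const lim_1_over_n[THEN LIMSEQ_Suc]])
        (use t in \<open>auto intro!: always_eventually less_imp_le\<close>)
    have lim: "(\<lambda>k. feature_integral \<mu> (z, t k)) \<longlonglongrightarrow> measure \<mu> UNIV"
      if \<mu>: "finite_measure \<mu>" and s\<mu>[measurable_cong]: "sets \<mu> = sets borel" for \<mu> :: "'a measure"
    proof -
      interpret finite_measure \<mu> by fact
      have "(\<lambda>k. feature_integral \<mu> (z, t k)) \<longlonglongrightarrow> (\<integral>x. 1 \<partial>\<mu>)"
        unfolding feature_integral_def
      proof (rule integral_dominated_convergence[where w = "\<lambda>_. 1"])
        have "(\<lambda>k. feature (z, t k) x) \<longlonglongrightarrow> exp (- (2 * \<bar>0\<bar> * (norm (x - z))\<^sup>2))" for x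
          unfolding feature_def fst_conv snd_conv by (intro tendsto_intros t0)
        then show "AE x in \<mu>. (\<lambda>k. feature (z, t k) x) \<longlonglongrightarrow> 1" by simp
      qed (auto simp: feature_bounds)
      moreover have "space \<mu> = UNIV" using sets_eq_imp_space_eq[OF s\<mu>] by simp
      ultimately show ?thesis by simp
    qed
    have "measure \<rho> UNIV = measure \<nu> UNIV"
      using LIMSEQ_unique[OF lim[OF \<rho> s\<rho>]] lim[OF \<nu> s\<nu>] t(3) by (simp add: r_def n_def)
    then show False using ne by simp
  qed
  moreover have "2 * mutual_energy b \<rho> \<nu> \<noteq> \<top>"
  proof
    assume "2 * mutual_energy b \<rho> \<nu> = \<top>"
    then show False using eq fin by (auto simp: top_add)
  qed
  ultimately show ?thesis
    unfolding eq using ennreal_add_left_cancel_less[of "2 * mutual_energy b \<rho> \<nu>" 0 D]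
    by (simp add: zero_less_iff_neq_zero)
qed

section \<open>Potentials of bounded densities\<close>

lemma riesz_kernel_minus: "riesz_kernel b (x - y) = riesz_kernel b (y - x)"
  by (simp add: riesz_kernel_def norm_minus_commute)

definition riesz_ball_mass :: "'a::euclidean_space itself \<Rightarrow> real \<Rightarrow> real \<Rightarrow> ennreal" where
  "riesz_ball_mass _ b r = (\<integral>\<^sup>+z. riesz_kernel b z * indicator (cball 0 r) z \<partial>(lborel :: 'a measure))"

lemma riesz_kernel_AE: "AE z in lborel. riesz_kernel b (z::'a::euclidean_space) = ennreal (norm z powr b / - b)"
  using AE_lborel_singleton[of "0::'a"] by (auto elim!: eventually_mono simp: riesz_kernel_def)

lemma riesz_ball_mass_finite:
  assumes "b < 0" "1 - real DIM('a::euclidean_space) \<le> b"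
  shows "riesz_ball_mass TYPE('a) b r < \<infinity>"
proof -
  have i: "integrable lborel (\<lambda>z::'a. (indicator (cball 0 r) z *\<^sub>R norm z powr b) / - b)"
    using locally_integrable_norm_powr[OF assms] 
    unfolding locally_integrable_def set_integrable_def by (intro integrable_divide) blast
  have "riesz_ball_mass TYPE('a) b r = (\<integral>\<^sup>+z. ennreal ((indicator (cball 0 r) z *\<^sub>R norm z powr b) / - b) \<partial>(lborel :: 'a measure))"
    unfolding riesz_ball_mass_def
    by (rule nn_integral_cong_AE) (use riesz_kernel_AE[of b] in \<open>auto elim!: eventually_mono simp: indicator_def\<close>)
  also have "\<dots> \<le> (\<integral>\<^sup>+z. ennreal (norm ((indicator (cball 0 r) z *\<^sub>R norm z powr b) / - b)) \<partial>(lborel :: 'a measure))"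
    by (intro nn_integral_mono ennreal_leI) (unfold real_norm_def, rule abs_ge_self)
  also have "\<dots> < \<infinity>" using i unfolding integrable_iff_bounded by blast
  finally show ?thesis .
qed

lemma riesz_kernel_far:
  assumes "b < 0" "0 < r" "r \<le> norm z"
  shows "riesz_kernel b z \<le> ennreal (r powr b / - b)"
  using assms powr_mono2'[of b r "norm z"]
  by (auto simp: riesz_kernel_def intro!: ennreal_leI divide_right_mono_neg)

text \<open>Near \<open>x\<close> the density is at most \<open>A\<close>, away from \<open>x\<close> the kernel is at most its value at distance \<open>r\<close>.\<close>

lemma riesz_potential_le:
  fixes f :: "'a::euclidean_space \<Rightarrow> ennreal"
  assumes b: "b < 0" and [measurable]: "f \<in> borel_measurable borel" and A: "\<And>y. f y \<le> A" and r: "r > 0"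
  shows "(\<integral>\<^sup>+y. riesz_kernel b (x - y) * f y \<partial>lborel) \<le>
    A * riesz_ball_mass TYPE('a) b r + ennreal (r powr b / - b) * (\<integral>\<^sup>+y. f y \<partial>lborel)"
proof -
  define k where "k = (\<lambda>z::'a. riesz_kernel b z * indicator (cball 0 r) z)"
  have km[measurable]: "k \<in> borel_measurable borel"
    unfolding k_def by (intro borel_measurable_times_ennreal riesz_kernel_measurable borel_measurable_indicator) auto
  have "(\<integral>\<^sup>+y. riesz_kernel b (x - y) * f y \<partial>lborel) \<le>
      (\<integral>\<^sup>+y. A * k (x - y) + ennreal (r powr b / - b) * f y \<partial>lborel)"
  proof (rule nn_integral_mono)
    fix y
    show "riesz_kernel b (x - y) * f y \<le> A * k (x - y) + ennreal (r powr b / - b) * f y"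
    proof (cases "norm (x - y) \<le> r")
      case True
      have "riesz_kernel b (x - y) * f y \<le> riesz_kernel b (x - y) * A" by (intro mult_left_mono A) simp
      then show ?thesis using True by (simp add: k_def mult.commute add_increasing2)
    next
      case False
      have "riesz_kernel b (x - y) * f y \<le> ennreal (r powr b / - b) * f y"
        using False by (intro mult_right_mono riesz_kernel_far b r) auto
      then show ?thesis by (simp add: add_increasing)
    qed
  qed
  also have "\<dots> = A * (\<integral>\<^sup>+y. k (x - y) \<partial>lborel) + ennreal (r powr b / - b) * (\<integral>\<^sup>+y. f y \<partial>lborel)"
    by (subst nn_integral_add) (simp_all add: nn_integral_cmult)
  also have "(\<integral>\<^sup>+y. k (x - y) \<partial>lborel) = riesz_ball_mass TYPE('a) b r"
    unfolding riesz_ball_mass_def using nn_integral_reflect[OF km, of x] unfolding k_def .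
  finally show ?thesis .
qed


text \<open>A uniform density on a huge ball: by \<open>riesz_potential_le\<close> its potential is small when first the cut-off
radius \<open>r\<close> and then the ball are chosen large enough.\<close>

lemma spread_density:
  assumes b: "b < 0" "1 - real DIM('a::euclidean_space) \<le> b" and s: "0 \<le> s" "s \<le> 1" and e: "e > 0"
  obtains g :: "'a::euclidean_space \<Rightarrow> ennreal" where "g \<in> borel_measurable borel" "(\<integral>\<^sup>+y. g y \<partial>lborel) = ennreal s"
    "\<And>x. (\<integral>\<^sup>+y. riesz_kernel b (x - y) * g y \<partial>lborel) \<le> ennreal e"
proof -
  define r where "r = (e / 2 * - b) powr (1 / b)"
  have "e / 2 * - b > 0" using b e by (intro mult_pos_pos) auto
  then have r: "r > 0" "r powr b / - b = e / 2" using b by (auto simp: r_def powr_powr)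
  obtain C where C: "riesz_ball_mass TYPE('a) b r = ennreal C" "C \<ge> 0"
    using riesz_ball_mass_finite[OF b, of r] by (cases "riesz_ball_mass TYPE('a) b r") auto
  define v where "v = unit_ball_vol (real DIM('a))"
  have v: "v > 0" by (simp add: v_def)
  \<comment> \<open>the volume of the ball is at least \<open>v * N\<close>, so the near part of the potential is at most \<open>e / 2\<close>\<close>
  define N where "N = max 1 (2 * C / (e * v))"
  have N: "N \<ge> 1" "2 * C / (e * v) \<le> N" by (auto simp: N_def)
  define V where "V = v * N ^ DIM('a)"
  have vV: "v * N \<le> V" unfolding V_def using v N by (intro mult_left_mono self_le_power) auto
  have "2 * C \<le> N * (e * v)" using N(2) e v by (simp add: pos_divide_le_eq)
  also have "\<dots> \<le> e * V" using mult_left_mono[OF vV, of e] e by (simp add: mult_ac)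
  finally have V: "V > 0" "2 * C \<le> e * V"
    using v N by (auto simp: V_def)
  define g :: "'a \<Rightarrow> ennreal" where "g y = ennreal (s / V) * indicator (cball 0 N) y" for y
  have gm: "g \<in> borel_measurable borel"
    unfolding g_def[abs_def] by (intro borel_measurable_times_ennreal borel_measurable_indicator) auto
  have "(\<integral>\<^sup>+y. g y \<partial>lborel) = ennreal (s / V) * emeasure lborel (cball (0::'a) N)"
    unfolding g_def by (rule nn_integral_cmult_indicator) auto
  also have "emeasure lborel (cball (0::'a) N) = ennreal V"
    using N by (simp add: emeasure_cball V_def v_def)
  also have "ennreal (s / V) * ennreal V = ennreal s"
    using V s by (simp flip: ennreal_mult)
  finally have gi: "(\<integral>\<^sup>+y. g y \<partial>lborel) = ennreal s" .
  have "(\<integral>\<^sup>+y. riesz_kernel b (x - y) * g y \<partial>lborel) \<le> ennreal e" for x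
  proof -
    have "(\<integral>\<^sup>+y. riesz_kernel b (x - y) * g y \<partial>lborel) \<le>
        ennreal (s / V) * riesz_ball_mass TYPE('a) b r + ennreal (r powr b / - b) * (\<integral>\<^sup>+y. g y \<partial>lborel)"
      by (rule riesz_potential_le[OF b(1) gm _ r(1)]) (simp add: g_def indicator_def)
    also have "\<dots> = ennreal (s / V * C + e / 2 * s)"
      unfolding gi r(2) C(1) using s V e C(2) by (simp flip: ennreal_mult ennreal_plus)
    also have "\<dots> \<le> ennreal e"
    proof (rule ennreal_leI)
      have "s / V * C \<le> 1 / V * C" using s V C by (intro mult_right_mono divide_right_mono) auto
      also have "\<dots> \<le> e / 2" using V by (simp add: field_simps)
      finally have "s / V * C \<le> e / 2" .
      moreover have "e / 2 * s \<le> e / 2" using s e by (simp add: mult_left_le)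
      ultimately show "s / V * C + e / 2 * s \<le> e" by linarith
    qed
    finally show ?thesis .
  qed
  with gm gi show ?thesis by (rule that)
qed

section \<open>Absence of minimizers\<close>

lemma mutual_energy_density:
  fixes f g :: "'a::euclidean_space \<Rightarrow> ennreal"
  assumes [measurable]: "f \<in> borel_measurable borel" "g \<in> borel_measurable borel"
  shows "mutual_energy b (density lborel f) (density lborel g) =
    (\<integral>\<^sup>+x. f x * (\<integral>\<^sup>+y. riesz_kernel b (x - y) * g y \<partial>lborel) \<partial>lborel)"
  unfolding mutual_energy_def by (simp add: nn_integral_density mult.commute)

lemma mutual_energy_density_right:
  fixes g :: "'a::euclidean_space \<Rightarrow> ennreal"
  assumes [measurable]: "g \<in> borel_measurable borel"
  shows "mutual_energy b \<rho> (density lborel g) = (\<integral>\<^sup>+x. (\<integral>\<^sup>+y. riesz_kernel b (x - y) * g y \<partial>lborel) \<partial>\<rho>)"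
  unfolding mutual_energy_def by (simp add: nn_integral_density mult.commute)

lemma mutual_energy_density_commute:
  fixes f g :: "'a::euclidean_space \<Rightarrow> ennreal"
  assumes [measurable]: "f \<in> borel_measurable borel" "g \<in> borel_measurable borel"
  shows "mutual_energy b (density lborel f) (density lborel g) = mutual_energy b (density lborel g) (density lborel f)"
proof -
  have "(\<integral>\<^sup>+x. f x * (\<integral>\<^sup>+y. riesz_kernel b (x - y) * g y \<partial>lborel) \<partial>lborel) =
      (\<integral>\<^sup>+x. (\<integral>\<^sup>+y. f x * (riesz_kernel b (x - y) * g y) \<partial>lborel) \<partial>lborel)"
    by (simp add: nn_integral_cmult)
  also have "\<dots> = (\<integral>\<^sup>+y. (\<integral>\<^sup>+x. f x * (riesz_kernel b (x - y) * g y) \<partial>lborel) \<partial>lborel)"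
    by (rule lborel_pair.Fubini') measurable
  also have "\<dots> = (\<integral>\<^sup>+y. (\<integral>\<^sup>+x. g y * (riesz_kernel b (y - x) * f x) \<partial>lborel) \<partial>lborel)"
    by (intro nn_integral_cong) (subst riesz_kernel_minus, simp only: mult_ac)
  also have "\<dots> = (\<integral>\<^sup>+y. g y * (\<integral>\<^sup>+x. riesz_kernel b (y - x) * f x \<partial>lborel) \<partial>lborel)"
    by (simp add: nn_integral_cmult)
  finally show ?thesis by (simp add: mutual_energy_density)
qed

lemma mutual_energy_density_add_right:
  fixes f g :: "'a::euclidean_space \<Rightarrow> ennreal"
  assumes [measurable]: "f \<in> borel_measurable borel" "g \<in> borel_measurable borel" and s[measurable_cong]: "sets \<rho> = sets borel"
  shows "mutual_energy b \<rho> (density lborel (\<lambda>x. f x + g x)) =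
    mutual_energy b \<rho> (density lborel f) + mutual_energy b \<rho> (density lborel g)"
  by (simp add: mutual_energy_density_right distrib_left nn_integral_add)

lemma e2ennreal_power_potential: "b < 0 \<Longrightarrow> e2ennreal (power_potential b z) = riesz_kernel b z"
  by (simp add: power_potential_def riesz_kernel_def)

lemma e2ennreal_minus_power_potential: "b < 0 \<Longrightarrow> e2ennreal (- power_potential b z) = 0"
  by (auto simp: power_potential_def e2ennreal_neg divide_nonneg_neg)

lemma ereal_integral_power_potential:
  "b < 0 \<Longrightarrow> ereal_integral \<rho> (\<lambda>y. power_potential b (x - y)) = enn2ereal (\<integral>\<^sup>+y. riesz_kernel b (x - y) \<partial>\<rho>)"
  by (simp add: ereal_integral_def e2ennreal_power_potential e2ennreal_minus_power_potential zero_ennreal.rep_eq)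

text \<open>The kernel is nonnegative and the external potential nonpositive, so in each of the extended real
integrals either the positive or the negative part vanishes.\<close>

lemma energy_eq:
  fixes u :: "'a::euclidean_space \<Rightarrow> real"
  assumes b: "b < 0" and u: "\<And>x. 0 \<le> u x"
  shows "energy (power_potential b) (\<lambda>x. - u x) \<rho> =
    ereal (1 / 2) * enn2ereal (mutual_energy b \<rho> \<rho>) - enn2ereal (\<integral>\<^sup>+x. ennreal (u x) \<partial>\<rho>)"
proof -
  have "ereal_integral \<rho> (\<lambda>x. enn2ereal (h x)) = enn2ereal (\<integral>\<^sup>+x. h x \<partial>\<rho>)" for h :: "'a \<Rightarrow> ennreal"
    by (simp add: ereal_integral_def e2ennreal_neg zero_ennreal.rep_eq)
  moreover have "ereal_integral \<rho> (\<lambda>x. ereal (- u x)) = - enn2ereal (\<integral>\<^sup>+x. ennreal (u x) \<partial>\<rho>)"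
    using u by (simp add: ereal_integral_def ennreal_neg zero_ennreal.rep_eq)
  ultimately show ?thesis
    by (simp add: energy_def ereal_integral_power_potential[OF b] mutual_energy_def minus_ereal_def)
qed


text \<open>The energy exceeds \<open>- I(\<nu>, \<nu>) / 2\<close> at every probability measure by strict positive definiteness, while
the probability measures \<open>\<nu> + \<tau>\<close>, with \<open>\<tau>\<close> a thinly spread remainder of mass \<open>1 - m\<close>, have energy
\<open>- I(\<nu>, \<nu>) / 2 + I(\<tau>, \<tau>) / 2\<close>: the mixed terms cancel.\<close>

theorem no_minimizer_subunit_background:
  fixes f u :: "'a::euclidean_space \<Rightarrow> real"
  assumes b: "b < 0" "1 - real DIM('a) \<le> b"
    and [measurable]: "f \<in> borel_measurable borel" and f: "\<And>x. 0 \<le> f x" "\<And>x. f x \<le> A"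
    and m: "(\<integral>\<^sup>+x. ennreal (f x) \<partial>lborel) = ennreal m" "0 \<le> m" "m < 1"
    and u: "\<And>x. 0 \<le> u x" "\<And>x. ennreal (u x) = (\<integral>\<^sup>+y. riesz_kernel b (x - y) * ennreal (f y) \<partial>lborel)"
  shows "\<not> is_minimizer (power_potential b) (\<lambda>x. - u x) \<rho>"
proof
  let ?E = "energy (power_potential b) (\<lambda>x. - u x)"
  assume "is_minimizer (power_potential b) (\<lambda>x. - u x) \<rho>"
  then have \<rho>: "prob_space \<rho>" and s\<rho>[measurable_cong]: "sets \<rho> = sets borel"
    and min: "\<And>\<mu>. \<mu> \<in> borel_probs \<Longrightarrow> ?E \<rho> \<le> ?E \<mu>"
    by (auto simp: is_minimizer_def borel_probs_def)
  interpret \<rho>: prob_space \<rho> by fact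
  define \<nu> where "\<nu> = density lborel (\<lambda>x. ennreal (f x))"
  have s\<nu>: "sets \<nu> = sets borel" by (simp add: \<nu>_def)
  have em\<nu>: "emeasure \<nu> UNIV = ennreal m" using m by (simp add: \<nu>_def emeasure_density)
  have fin\<nu>: "finite_measure \<nu>" using em\<nu> by (intro finite_measureI) (simp add: \<nu>_def)
  have E: "?E \<mu> = ereal (1 / 2) * enn2ereal (mutual_energy b \<mu> \<mu>) - enn2ereal (mutual_energy b \<mu> \<nu>)" for \<mu>
    unfolding energy_eq[of b u, OF b(1) u(1)] u(2) \<nu>_def
    by (subst mutual_energy_density_right) simp_all
  obtain C where C: "riesz_ball_mass TYPE('a) b 1 = ennreal C" "C \<ge> 0"
    using riesz_ball_mass_finite[OF b, of 1] by (cases "riesz_ball_mass TYPE('a) b 1") auto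
  define P where "P = A * C + 1 / - b * m"
  have A: "0 \<le> A" using f[of 0] by linarith
  have P0: "0 \<le> P" unfolding P_def using A C m b by (intro add_nonneg_nonneg mult_nonneg_nonneg) (auto intro: divide_nonneg_pos)
  have uP: "ennreal (u x) \<le> ennreal P" for x
  proof -
    have "ennreal (u x) \<le> ennreal A * riesz_ball_mass TYPE('a) b 1 + ennreal (1 powr b / - b) * ennreal m"
      unfolding u(2) m(1)[symmetric] by (rule riesz_potential_le) (use b f in \<open>auto intro: ennreal_leI\<close>)
    also have "\<dots> = ennreal P"
    proof -
      have "0 \<le> 1 / - b" using b by simp
      then show ?thesis
        unfolding P_def C(1) using A C(2) m b by (simp only: powr_one_eq_one ennreal_mult ennreal_plus mult_nonneg_nonneg)
    qed
    finally show ?thesis .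
  qed
  have bd: "mutual_energy b \<mu> \<nu> \<le> ennreal P * emeasure \<mu> (space \<mu>)" if "sets \<mu> = sets borel" for \<mu>
    unfolding \<nu>_def
    by (subst mutual_energy_density_right, simp)
      (use uP nn_integral_mono[of \<mu> _ "\<lambda>_. ennreal P"] in \<open>simp add: u(2)\<close>)
  have "mutual_energy b \<rho> \<nu> \<le> ennreal P * 1" using bd[OF s\<rho>] \<rho>.emeasure_space_1 by simp
  then obtain c where c: "mutual_energy b \<rho> \<nu> = ennreal c" "c \<ge> 0"
    by (cases "mutual_energy b \<rho> \<nu>") (auto simp: top_unique)
  have "mutual_energy b \<nu> \<nu> \<le> ennreal P * ennreal m" using bd[OF s\<nu>] em\<nu> by (simp add: \<nu>_def)
  then obtain n where n: "mutual_energy b \<nu> \<nu> = ennreal n" "n \<ge> 0"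
    by (cases "mutual_energy b \<nu> \<nu>") (auto simp: top_unique ennreal_mult_eq_top_iff)
  \<comment> \<open>the test measures come arbitrarily close to minus half the energy of the background\<close>
  have test: "?E \<rho> \<le> ereal (- n / 2 + e)" if e: "e > 0" for e
  proof -
    obtain g :: "'a \<Rightarrow> ennreal" where g[measurable]: "g \<in> borel_measurable borel"
      and gi: "(\<integral>\<^sup>+y. g y \<partial>lborel) = ennreal (1 - m)"
      and gK: "\<And>x. (\<integral>\<^sup>+y. riesz_kernel b (x - y) * g y \<partial>lborel) \<le> ennreal e"
      by (rule spread_density[OF b, of "1 - m" e]) (use m e in auto)
    define \<tau> where "\<tau> = density lborel g"
    define \<mu> where "\<mu> = density lborel (\<lambda>x. ennreal (f x) + g x)"
    have "emeasure \<mu> UNIV = ennreal m + ennreal (1 - m)"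
      by (simp add: \<mu>_def emeasure_density nn_integral_add m gi)
    also have "\<dots> = 1" using m by (simp flip: ennreal_plus)
    finally have \<mu>: "\<mu> \<in> borel_probs"
      unfolding borel_probs_def by (auto simp: \<mu>_def intro!: prob_spaceI)
    have [simp]: "sets \<mu> = sets borel" "sets \<tau> = sets borel" by (simp_all add: \<mu>_def \<tau>_def)
    have tt: "mutual_energy b \<tau> \<tau> \<le> ennreal e"
    proof -
      have "mutual_energy b \<tau> \<tau> \<le> (\<integral>\<^sup>+x. g x * ennreal e \<partial>lborel)"
        unfolding \<tau>_def by (subst mutual_energy_density) (auto intro!: nn_integral_mono mult_left_mono gK)
      also have "\<dots> = ennreal (1 - m) * ennreal e" by (simp add: nn_integral_multc gi)
      also have "\<dots> \<le> ennreal e" using m e by (simp add: mult_left_le_one_le flip: ennreal_mult)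
      finally show ?thesis .
    qed
    then obtain t where t: "mutual_energy b \<tau> \<tau> = ennreal t" "t \<ge> 0" "t \<le> e"
      using e by (cases "mutual_energy b \<tau> \<tau>") (auto simp: top_unique)
    have "mutual_energy b \<tau> \<nu> \<le> ennreal P * ennreal (1 - m)"
      using bd[of \<tau>] by (simp add: \<tau>_def emeasure_density gi)
    then obtain k where k: "mutual_energy b \<tau> \<nu> = ennreal k" "k \<ge> 0"
      by (cases "mutual_energy b \<tau> \<nu>") (auto simp: top_unique ennreal_mult_eq_top_iff)
    have nt: "mutual_energy b \<nu> \<tau> = ennreal k"
      unfolding k(1)[symmetric] \<nu>_def \<tau>_def by (rule mutual_energy_density_commute) measurable
    have left: "mutual_energy b \<mu> \<sigma> = mutual_energy b \<nu> \<sigma> + mutual_energy b \<tau> \<sigma>" 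
      if "\<sigma> = \<nu> \<or> \<sigma> = \<tau>" for \<sigma>
    proof -
      have "mutual_energy b \<mu> \<sigma> = mutual_energy b \<sigma> \<mu>"
        using that unfolding \<mu>_def \<nu>_def \<tau>_def by (auto intro!: mutual_energy_density_commute)
      also have "\<dots> = mutual_energy b \<sigma> \<nu> + mutual_energy b \<sigma> \<tau>"
        unfolding \<mu>_def \<nu>_def \<tau>_def
        by (rule mutual_energy_density_add_right) (use that in \<open>auto simp: \<nu>_def\<close>)
      also have "\<dots> = mutual_energy b \<nu> \<sigma> + mutual_energy b \<tau> \<sigma>"
        using that k nt by (auto simp: add.commute)
      finally show ?thesis .
    qed
    have mn: "mutual_energy b \<mu> \<nu> = ennreal (n + k)"
      using n k by (simp add: left)
    have mt: "mutual_energy b \<mu> \<tau> = ennreal (k + t)"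
      using nt t k by (simp add: left)
    have "mutual_energy b \<mu> \<mu> = mutual_energy b \<mu> \<nu> + mutual_energy b \<mu> \<tau>"
      using mutual_energy_density_add_right[of "\<lambda>x. ennreal (f x)" g \<mu> b]
      by (simp add: \<mu>_def[symmetric] \<nu>_def[symmetric] \<tau>_def[symmetric])
    also have "\<dots> = ennreal (n + 2 * k + t)"
      unfolding mn mt using n k t by (simp flip: ennreal_plus)
    finally have mm: "mutual_energy b \<mu> \<mu> = ennreal (n + 2 * k + t)" .
    have "?E \<mu> = ereal (1 / 2 * (n + 2 * k + t) - (n + k))"
      unfolding E mm mn using n k t
      by (simp only: enn2ereal_ennreal add_nonneg_nonneg mult_nonneg_nonneg zero_le_numeral
          times_ereal.simps ereal_minus(1))
    also have "\<dots> \<le> ereal (- n / 2 + e)" using t e by (simp add: field_simps)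
    finally show ?thesis using min[OF \<mu>] by (rule order_trans[rotated])
  qed
  show False
  proof (cases "mutual_energy b \<rho> \<rho>")
    case top
    then have "?E \<rho> = \<infinity>" unfolding E c(1) using c(2) by (simp add: enn2ereal_ennreal)
    then show False using test[of 1] by simp
  next
    case (real a)
    have "2 * mutual_energy b \<rho> \<nu> < mutual_energy b \<rho> \<rho> + mutual_energy b \<nu> \<nu>"
    proof (rule mutual_energy_strict[OF b(1) _ s\<rho> fin\<nu> s\<nu>])
      show "finite_measure \<rho>" by unfold_locales
      have "space \<rho> = UNIV" using sets_eq_imp_space_eq[OF s\<rho>] by simp
      then have "measure \<rho> UNIV = 1" using \<rho>.prob_space by simp
      moreover have "measure \<nu> UNIV = m" using em\<nu> m by (simp add: measure_def)
      ultimately show "measure \<rho> UNIV \<noteq> measure \<nu> UNIV" using m by simp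
    qed (use real n in auto)
    then have "ennreal (2 * c) < ennreal (a + n)"
      using real c n by (simp add: ennreal_mult' flip: ennreal_plus)
    then have lt: "2 * c < a + n" using c by (simp add: ennreal_less_iff)
    have "?E \<rho> = ereal (a / 2 - c)"
      unfolding E c(1) real(2) using c real by (simp add: enn2ereal_ennreal)
    then have "a / 2 - c \<le> - n / 2 + (a + n - 2 * c) / 4"
      using test[of "(a + n - 2 * c) / 4"] lt by simp
    then show False using lt by (simp add: field_simps)
  qed
qed

section \<open>The counterexample\<close>

lemma riesz_potential_eq_integral:
  fixes h :: "'a::euclidean_space \<Rightarrow> real"
  assumes b: "b < 0" "1 - real DIM('a) \<le> b" and h: "smooth h" "\<And>x. 0 \<le> h x"
    and supp: "\<And>x. norm x > R \<Longrightarrow> h x = 0"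
  shows "(\<integral>\<^sup>+y. riesz_kernel b (x - y) * ennreal (h y) \<partial>lborel) =
    ennreal ((\<integral>z. norm z powr b * h (x - z) \<partial>lborel) / - b)"
proof -
  note [measurable] = smooth_measurable[OF h(1)]
  obtain B where B: "B \<ge> 0" "\<And>x. \<bar>h x\<bar> \<le> B"
    by (rule compact_support_bounded[of h R, OF smooth_continuous_on[OF h(1)] supp]) (assumption, rule that)
  have int: "integrable lborel (\<lambda>z. norm z powr b * h (x - z))"
    by (rule integrable_convolution[OF locally_integrable_norm_powr[OF b] _ B(2) supp]) auto
  have "(\<integral>\<^sup>+y. riesz_kernel b (x - y) * ennreal (h y) \<partial>lborel) =
      (\<integral>\<^sup>+z. riesz_kernel b (x - (x - z)) * ennreal (h (x - z)) \<partial>lborel)"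
    by (rule nn_integral_reflect[symmetric]) measurable
  also have "\<dots> = (\<integral>\<^sup>+z. ennreal (norm z powr b * h (x - z) / - b) \<partial>lborel)"
  proof (rule nn_integral_cong_AE)
    have "ennreal (norm z powr b / - b) * ennreal (h (x - z)) = ennreal (norm z powr b * h (x - z) / - b)" for z :: 'a
      using h(2)[of "x - z"] b by (subst ennreal_mult'[symmetric]) (auto simp: divide_nonneg_neg mult.commute)
    then show "AE z in lborel. riesz_kernel b (x - (x - z)) * ennreal (h (x - z)) = ennreal (norm z powr b * h (x - z) / - b)"
      using riesz_kernel_AE[of b] by (auto elim!: eventually_mono)
  qed
  also have "\<dots> = ennreal (\<integral>z. norm z powr b * h (x - z) / - b \<partial>lborel)"
  proof (rule nn_integral_eq_integral)
    show "integrable lborel (\<lambda>z. norm z powr b * h (x - z) / - b)" using int by (rule integrable_divide)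
    show "AE z in lborel. 0 \<le> norm z powr b * h (x - z) / - b"
      using h(2) b by (intro AE_I2 divide_nonneg_pos mult_nonneg_nonneg) auto
  qed
  finally show ?thesis by simp
qed

lemma riesz_potential_radial:
  fixes f :: "'a::euclidean_space \<Rightarrow> ennreal"
  assumes [measurable]: "f \<in> borel_measurable borel" and f: "\<And>x y. norm x = norm y \<Longrightarrow> f x = f y"
    and xy: "norm x = norm y"
  shows "(\<integral>\<^sup>+z. riesz_kernel b (x - z) * f z \<partial>lborel) = (\<integral>\<^sup>+z. riesz_kernel b (y - z) * f z \<partial>lborel)"
proof -
  have "(\<integral>\<^sup>+z. riesz_kernel b (w - z) * f z \<partial>lborel) = (\<integral>\<^sup>+z. f z * riesz_kernel b (w - z) \<partial>lborel)" for w
    by (simp add: mult.commute)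
  moreover have "(\<integral>\<^sup>+z. f z * riesz_kernel b (x - z) \<partial>lborel) = (\<integral>\<^sup>+z. f z * riesz_kernel b (y - z) \<partial>lborel)"
  proof (rule convolution_radial[OF f _ _ _ xy])
    show "riesz_kernel b v = riesz_kernel b w" if "norm v = norm w" for v w :: 'a
      using that by (metis norm_eq_zero riesz_kernel_def)
  qed measurable
  ultimately show ?thesis by simp
qed

text \<open>All the mass lies at distance at least \<open>norm x - R\<close> from \<open>x\<close>.\<close>

lemma riesz_potential_decay:
  fixes f :: "'a::euclidean_space \<Rightarrow> ennreal"
  assumes b: "b < 0" and [measurable]: "f \<in> borel_measurable borel"
    and supp: "\<And>y. norm y > R \<Longrightarrow> f y = 0" and x: "norm x > R"
  shows "(\<integral>\<^sup>+y. riesz_kernel b (x - y) * f y \<partial>lborel) \<le>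
    ennreal ((norm x - R) powr b / - b) * (\<integral>\<^sup>+y. f y \<partial>lborel)"
proof -
  have "(\<integral>\<^sup>+y. riesz_kernel b (x - y) * f y \<partial>lborel) \<le> (\<integral>\<^sup>+y. ennreal ((norm x - R) powr b / - b) * f y \<partial>lborel)"
  proof (rule nn_integral_mono)
    fix y
    show "riesz_kernel b (x - y) * f y \<le> ennreal ((norm x - R) powr b / - b) * f y"
    proof (cases "norm y \<le> R")
      case True
      then have "norm x - R \<le> norm (x - y)" using norm_triangle_ineq2[of x y] by linarith
      then show ?thesis using x by (intro mult_right_mono riesz_kernel_far b) auto
    qed (simp add: supp)
  qed
  also have "\<dots> = ennreal ((norm x - R) powr b / - b) * (\<integral>\<^sup>+y. f y \<partial>lborel)"
    by (rule nn_integral_cmult) measurable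
  finally show ?thesis .
qed

lemma integral_laplacian_eq_0:
  fixes h :: "'a::euclidean_space \<Rightarrow> real"
  assumes h: "smooth h" and supp: "\<And>x. norm x > R \<Longrightarrow> h x = 0"
  shows "(\<integral>z. laplacian h z \<partial>lborel) = 0"
proof -
  have "laplacian (\<lambda>_::'a. 1) z = 0" for z
    by (simp add: laplacian_def frechet_derivative_const)
  then show ?thesis
    using Green_second_identity[OF smooth_const[of 1] h supp] by simp
qed

lemma bump_integral_pos:
  assumes r: "r > 0"
  shows "0 < (\<integral>z. bump (r\<^sup>2) (z::'a::euclidean_space) \<partial>lborel)"
proof -
  have s: "smooth (bump (r\<^sup>2) :: 'a \<Rightarrow> real)" using smooth_bump[of "r\<^sup>2" "0::'a"] by simp
  note [measurable] = smooth_measurable[OF s]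
  have "integrable lborel (\<lambda>z::'a. 1 * bump (r\<^sup>2) z)"
    by (rule integrable_mult_compact_support[where R = r])
      (use r bump_support[of r] smooth_continuous_on[OF s] in auto)
  then have int: "integrable lborel (bump (r\<^sup>2) :: 'a \<Rightarrow> real)" by simp
  have "(\<integral>z. bump (r\<^sup>2) (z::'a) \<partial>lborel) \<noteq> 0"
  proof
    assume "(\<integral>z. bump (r\<^sup>2) (z::'a) \<partial>lborel) = 0"
    then have "AE z in lborel. bump (r\<^sup>2) (z::'a) = 0"
      using integral_nonneg_eq_0_iff_AE[OF int] by (simp add: bump_nonneg)
    then obtain z :: 'a where "z \<in> ball 0 r" "bump (r\<^sup>2) z = 0"
      by (rule AE_lborel_ex[where S = "ball 0 r"]) (use r in auto)
    moreover from this have "(norm z)\<^sup>2 < r\<^sup>2" by (intro power_strict_mono) auto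
    ultimately show False by (simp add: bump_def flat_0)
  qed
  moreover have "(\<integral>z. bump (r\<^sup>2) (z::'a) \<partial>lborel) \<ge> 0" by (simp add: bump_nonneg)
  ultimately show ?thesis by linarith
qed

text \<open>The construction described at the beginning, with a background of mass \<open>1 - \<delta>\<close> and the radius two.
The bump \<open>\<eta>\<close> is supported on the ball of radius two and bounded below on the unit ball, which
contains the support of \<open>\<psi>\<close>, the Laplacian of the smaller bump; this makes \<open>f = \<eta> + l \<psi>\<close> nonnegative
for small \<open>l\<close>. The function \<open>P\<close> is the potential of \<open>\<eta>\<close>, and \<open>Q\<close> is that of \<open>\<psi>\<close>, which is at
most \<open>- c\<close> on the ball.\<close>

theorem superharmonic_counterexample:
  fixes b :: real
  assumes b: "2 - real DIM('a::euclidean_space) < b" "b < 0"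
  shows "\<exists>U :: 'a::euclidean_space \<Rightarrow> real.
           smooth U \<and> radial U \<and> (U \<longlongrightarrow> 0) at_infinity \<and>
           (\<exists>\<rho> \<in> borel_probs. \<exists>R > 0.
              smooth_radial_measure \<rho> \<and> supported_on \<rho> (cball 0 R) \<and>
              (SUP x \<in> ball 0 R. generated_potential (power_potential b) U \<rho> x) < 0) \<and>
           \<not> (\<exists>\<rho>. is_minimizer (power_potential b) U \<rho>)"
proof -
  have b': "b < 0" "1 - real DIM('a) \<le> b" using b by auto
  define Z where "Z = (\<integral>z. bump 4 (z::'a) \<partial>lborel)"
  define \<eta> :: "'a \<Rightarrow> real" where "\<eta> x = (1 / Z) * bump 4 x" for x
  define \<psi> :: "'a \<Rightarrow> real" where "\<psi> = laplacian (bump 1)"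
  have Z: "Z > 0" using bump_integral_pos[of 2, where 'a = 'a] by (simp add: Z_def)
  have sb: "smooth (bump c :: 'a \<Rightarrow> real)" for c using smooth_bump[of c "0::'a"] by simp
  have s\<eta>: "smooth \<eta>" unfolding \<eta>_def by (intro smooth_mult smooth_const sb)
  have s\<psi>: "smooth \<psi>" unfolding \<psi>_def by (rule smooth_laplacian[OF sb])
  have supp1: "bump 1 x = 0" if "norm x > 1" for x :: 'a using bump_support[of 1 x] that by simp
  have supp\<psi>: "\<psi> x = 0" if "norm x > 1" for x unfolding \<psi>_def by (rule support_laplacian[OF supp1 that])
  have supp\<eta>: "\<eta> x = 0" if "norm x > 2" for x using bump_support[of 2 x] that by (simp add: \<eta>_def)
  have \<eta>0: "0 \<le> \<eta> x" for x using Z by (simp add: \<eta>_def bump_nonneg)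
  have rad\<eta>: "\<eta> x = \<eta> y" if "norm x = norm y" for x y
    using that by (simp add: \<eta>_def bump_def)
  have rad\<psi>: "\<psi> x = \<psi> y" if "norm x = norm y" for x y
    using that laplacian_bump[of 1 "0::'a" x] laplacian_bump[of 1 "0::'a" y] by (simp add: \<psi>_def)
  note [measurable] = smooth_measurable[OF s\<eta>] smooth_measurable[OF s\<psi>]
  have int_supp: "integrable lborel h" if "smooth h" "\<And>x. norm x > r \<Longrightarrow> h x = 0" for h :: "'a \<Rightarrow> real" and r
    using integrable_mult_compact_support[OF continuous_on_const[of _ 1] smooth_continuous_on[OF that(1)] that(2)]
    by simp
  have int\<eta>: "integrable lborel \<eta>" by (rule int_supp[OF s\<eta> supp\<eta>])
  have int\<psi>: "integrable lborel \<psi>" by (rule int_supp[OF s\<psi> supp\<psi>])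
  have I\<eta>: "(\<integral>x. \<eta> x \<partial>lborel) = 1" using Z by (simp add: \<eta>_def Z_def)
  have I\<psi>: "(\<integral>x. \<psi> x \<partial>lborel) = 0" unfolding \<psi>_def by (rule integral_laplacian_eq_0[OF sb supp1])
  have nI\<eta>: "(\<integral>\<^sup>+x. ennreal (\<eta> x) \<partial>lborel) = 1"
    using nn_integral_eq_integral[OF int\<eta>] I\<eta> \<eta>0 by simp

  obtain L where L: "L \<ge> 0" "\<And>x. \<bar>\<psi> x\<bar> \<le> L"
    by (rule compact_support_bounded[of \<psi> 1, OF smooth_continuous_on[OF s\<psi>] supp\<psi>]) (assumption, rule that)
  \<comment> \<open>on the unit ball \<open>\<eta>\<close> is at least \<open>exp (- 1 / 3) / Z\<close>, since \<open>4 - (norm x)\<^sup>2 \<ge> 3\<close> there\<close>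
  define l where "l = (1 / Z) * exp (- 1 / 3) / (L + 1)"
  have l: "l > 0" using Z L(1) by (simp add: l_def)
  define f where "f x = \<eta> x + l * \<psi> x" for x
  have sf: "smooth f" unfolding f_def by (intro smooth_add smooth_mult smooth_const s\<eta> s\<psi>)
  note [measurable] = smooth_measurable[OF sf]
  have f0: "0 \<le> f x" for x
  proof (cases "norm x \<le> 1")
    case True
    then have "(norm x)\<^sup>2 \<le> 1" by (simp add: power_le_one)
    then have "exp (- 1 / 3) \<le> bump 4 x"
      using flat_0_mono[of 3 "4 - (norm x)\<^sup>2"] by (simp add: bump_def flat_0[of 3])
    then have "(1 / Z) * exp (- 1 / 3) \<le> \<eta> x" unfolding \<eta>_def using Z by (intro mult_left_mono) auto
    moreover have "l * \<bar>\<psi> x\<bar> \<le> l * (L + 1)" using l L(2)[of x] by (intro mult_left_mono) auto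
    moreover have "l * (L + 1) = (1 / Z) * exp (- 1 / 3)" using L(1) by (simp add: l_def)
    moreover have "- (l * \<bar>\<psi> x\<bar>) \<le> l * \<psi> x"
      using l by (metis abs_ge_minus_self abs_mult abs_of_pos minus_le_iff)
    ultimately show ?thesis unfolding f_def by linarith
  qed (simp add: f_def supp\<psi> \<eta>0)
  have suppf: "f x = 0" if "norm x > 2" for x using that by (simp add: f_def supp\<eta> supp\<psi>)
  have nIf: "(\<integral>\<^sup>+x. ennreal (f x) \<partial>lborel) = 1"
  proof -
    have "(\<integral>\<^sup>+x. ennreal (f x) \<partial>lborel) = ennreal (\<integral>x. f x \<partial>lborel)"
      by (rule nn_integral_eq_integral[OF int_supp[OF sf suppf]]) (simp_all add: f0 AE_I2)
    also have "(\<integral>x. f x \<partial>lborel) = 1" unfolding f_def using int\<eta> int\<psi> I\<eta> I\<psi> by simp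
    finally show ?thesis by simp
  qed
  define \<rho> where "\<rho> = density lborel (\<lambda>x. ennreal (f x))"
  have \<rho>: "\<rho> \<in> borel_probs"
    unfolding borel_probs_def by (auto simp: \<rho>_def emeasure_density nIf intro!: prob_spaceI)

  define P where "P x = (\<integral>z. norm z powr b * \<eta> (x - z) \<partial>lborel) / - b" for x
  define Q where "Q x = (\<integral>z. norm z powr b * \<psi> (x - z) \<partial>lborel) / - b" for x
  note li = locally_integrable_norm_powr[OF b']
  have sP: "smooth P"
  proof -
    have "smooth (\<lambda>x. (\<integral>z. norm z powr b * \<eta> (x - z) \<partial>lborel) * (1 / - b))"
      by (intro smooth_mult smooth_const smooth_convolution[OF li s\<eta> supp\<eta>])
    then show ?thesis by (simp add: P_def[abs_def])
  qed
  have P0: "0 \<le> P x" for x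
    unfolding P_def using b \<eta>0 by (intro divide_nonneg_pos integral_nonneg) auto
  have potP: "(\<integral>\<^sup>+y. riesz_kernel b (x - y) * ennreal (\<eta> y) \<partial>lborel) = ennreal (P x)" for x
    unfolding P_def by (rule riesz_potential_eq_integral[OF b' s\<eta> \<eta>0 supp\<eta>])
  have convf: "(\<integral>z. norm z powr b * f (x - z) \<partial>lborel) / - b = P x + l * Q x" for x
  proof -
    obtain B where B: "B \<ge> 0" "\<And>x. \<bar>\<eta> x\<bar> \<le> B"
      by (rule compact_support_bounded[of \<eta> 2, OF smooth_continuous_on[OF s\<eta>] supp\<eta>]) (assumption, rule that)
    have "integrable lborel (\<lambda>z. norm z powr b * \<eta> (x - z))"
      by (rule integrable_convolution[OF li _ B(2), where R = 2]) (auto simp: supp\<eta>)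
    moreover have "integrable lborel (\<lambda>z. norm z powr b * \<psi> (x - z))"
      by (rule integrable_convolution[OF li _ L(2), where R = 1]) (auto simp: supp\<psi>)
    ultimately have "(\<integral>z. norm z powr b * f (x - z) \<partial>lborel) =
        (\<integral>z. norm z powr b * \<eta> (x - z) \<partial>lborel) + l * (\<integral>z. norm z powr b * \<psi> (x - z) \<partial>lborel)"
      unfolding f_def distrib_left by (simp add: mult.left_commute)
    then show "(\<integral>z. norm z powr b * f (x - z) \<partial>lborel) / - b = P x + l * Q x"
      unfolding P_def Q_def by (simp add: add_divide_distrib)
  qed
  have potf: "(\<integral>\<^sup>+y. riesz_kernel b (x - y) * ennreal (f y) \<partial>lborel) = ennreal (P x + l * Q x)" for x
    unfolding convf[symmetric] by (rule riesz_potential_eq_integral[OF b' sf f0 suppf])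

  define c where "c = (b + real DIM('a) - 2) * 10 powr (b / 2 - 1) * (\<integral>z. bump 1 (z::'a) \<partial>lborel)"
  have c: "c > 0"
    using b bump_integral_pos[of 1, where 'a = 'a] by (simp add: c_def)
  have Q: "Q x \<le> - c" if "norm x \<le> 2" for x
    using riesz_superharmonic[OF b'(1) b(1) that] b
    by (simp add: Q_def \<psi>_def c_def field_simps)
  obtain M where M: "\<And>x. norm x \<le> 2 \<Longrightarrow> P x \<le> M"
  proof -
    have "bounded (P ` cball 0 2)"
      by (intro compact_imp_bounded compact_continuous_image smooth_continuous_on sP) auto
    then obtain M where "\<forall>x\<in>cball 0 2. \<bar>P x\<bar> \<le> M" by (auto simp: bounded_iff)
    then show ?thesis using that[of M] by (meson abs_le_D1 mem_cball_0)
  qed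
  have M0: "0 \<le> M" using M[of 0] P0[of 0] by simp
  \<comment> \<open>the missing mass costs at most \<open>\<delta> * M\<close>, which is at most half of what the Laplacian gains\<close>
  define \<delta> where "\<delta> = min (1 / 2) (l * c / (2 * (M + 1)))"
  have \<delta>: "0 < \<delta>" "\<delta> < 1" "\<delta> * M \<le> l * c / 2"
  proof -
    show "0 < \<delta>" "\<delta> < 1" using l c M0 by (auto simp: \<delta>_def)
    have "\<delta> * M \<le> l * c / (2 * (M + 1)) * (M + 1)"
      using l c M0 by (intro mult_mono) (auto simp: \<delta>_def)
    also have "\<dots> = l * c / 2" using M0 by (simp add: divide_simps)
    finally show "\<delta> * M \<le> l * c / 2" .
  qed
  define U where "U x = - ((1 - \<delta>) * P x)" for x
  have gen: "generated_potential (power_potential b) U \<rho> x \<le> ereal (- (l * c / 2))" if "norm x \<le> 2" for x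
  proof -
    have nn: "0 \<le> P x + l * Q x"
      unfolding convf[symmetric] using b f0 by (intro divide_nonneg_pos integral_nonneg) auto
    have "conv_measure (power_potential b) \<rho> x = ereal (P x + l * Q x)"
      unfolding conv_measure_def ereal_integral_power_potential[OF b(2)] \<rho>_def
      using potf[of x] nn by (simp add: nn_integral_density mult.commute enn2ereal_ennreal)
    moreover have "P x + l * Q x + U x \<le> - (l * c / 2)"
    proof -
      have "l * Q x \<le> l * (- c)" using Q[OF that] l by (intro mult_left_mono) auto
      moreover have "\<delta> * P x \<le> \<delta> * M" using M[OF that] \<delta> by (intro mult_left_mono) auto
      moreover have "P x + l * Q x + U x = \<delta> * P x + l * Q x" by (simp add: U_def algebra_simps)
      ultimately show ?thesis using \<delta>(3) by simp
    qed
    ultimately show ?thesis by (simp add: generated_potential_def)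
  qed
  have "(SUP x \<in> ball 0 2. generated_potential (power_potential b) U \<rho> x) \<le> ereal (- (l * c / 2))"
    by (rule SUP_least) (simp add: gen)
  also have "\<dots> < 0" using l c by simp
  finally have sup: "(SUP x \<in> ball 0 2. generated_potential (power_potential b) U \<rho> x) < 0" .
  have radf: "f x = f y" if "norm x = norm y" for x y
    unfolding f_def by (simp only: rad\<eta>[OF that] rad\<psi>[OF that])
  have srm: "smooth_radial_measure \<rho>"
    unfolding smooth_radial_measure_def radial_def \<rho>_def
    using sf f0 radf by blast
  have so: "supported_on \<rho> (cball 0 2)"
  proof -
    have z: "ennreal (f x) * indicator (- cball 0 2) x = 0" for x
      using suppf[of x] by (cases "norm x \<le> 2") auto
    have "emeasure \<rho> (- cball 0 2) = (\<integral>\<^sup>+x. ennreal (f x) * indicator (- cball 0 2) x \<partial>lborel)"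
      unfolding \<rho>_def by (rule emeasure_density) auto
    then show ?thesis by (simp only: z supported_on_def nn_integral_const mult_zero_left)
  qed

  have radP: "P x = P y" if "norm x = norm y" for x y
  proof -
    have "ennreal (P x) = ennreal (P y)"
      unfolding potP[symmetric]
    proof (rule riesz_potential_radial[OF _ _ that])
      show "ennreal (\<eta> v) = ennreal (\<eta> w)" if "norm v = norm w" for v w
        by (simp only: rad\<eta>[OF that])
    qed measurable
    then show ?thesis using P0 by simp
  qed
  have limP: "(P \<longlongrightarrow> 0) at_infinity"
  proof (rule tendsto_sandwich[OF _ _ tendsto_const])
    show "\<forall>\<^sub>F x in at_infinity. 0 \<le> P x" by (simp add: P0)
    have "P x \<le> (norm x - 2) powr b / - b" if "norm x > 2" for x
    proof -
      have "ennreal (P x) \<le> ennreal ((norm x - 2) powr b / - b) * 1"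
        unfolding potP[symmetric] nI\<eta>[symmetric]
        by (rule riesz_potential_decay[OF b(2)]) (use that supp\<eta> in auto)
      then show ?thesis using b by (simp add: ennreal_le_iff divide_nonneg_neg)
    qed
    then show "\<forall>\<^sub>F x in at_infinity. P x \<le> (norm x - 2) powr b / - b"
      unfolding eventually_at_infinity by (intro exI[of _ 3]) auto
    have "filterlim (\<lambda>x::'a. - 2 + norm x) at_top at_infinity"
      by (rule filterlim_tendsto_add_at_top[OF tendsto_const filterlim_norm_at_top])
    then have "((\<lambda>x::'a. (- 2 + norm x) powr b / - b) \<longlongrightarrow> 0 / - b) at_infinity"
      using b by (intro tendsto_divide tendsto_neg_powr tendsto_const) auto
    then show "((\<lambda>x::'a. (norm x - 2) powr b / - b) \<longlongrightarrow> 0) at_infinity" by simp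
  qed
  have "(U \<longlongrightarrow> 0) at_infinity"
    unfolding U_def[abs_def] using tendsto_minus[OF tendsto_mult[OF tendsto_const[of "1 - \<delta>"] limP]] by simp
  moreover have "smooth U"
    using smooth_mult[OF smooth_const[of "- (1 - \<delta>)"] sP] by (simp only: U_def[abs_def] mult_minus_left)
  moreover have "radial U"
    unfolding radial_def
  proof (intro allI impI)
    fix x y :: 'a
    assume "norm x = norm y"
    then show "U x = U y" by (simp only: U_def radP[of x y])
  qed
  moreover have "\<not> is_minimizer (power_potential b) U \<mu>" for \<mu>
  proof -
    obtain A where A: "\<And>x. \<bar>\<eta> x\<bar> \<le> A"
      by (rule compact_support_bounded[of \<eta> 2, OF smooth_continuous_on[OF s\<eta>] supp\<eta>]) (assumption, rule that)
    show ?thesis unfolding U_def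
    proof (rule no_minimizer_subunit_background[OF b', where f = "\<lambda>x. (1 - \<delta>) * \<eta> x" and m = "1 - \<delta>" and A = "A"])
      show "(\<integral>\<^sup>+x. ennreal ((1 - \<delta>) * \<eta> x) \<partial>lborel) = ennreal (1 - \<delta>)"
        using \<delta> \<eta>0 nI\<eta> by (simp add: ennreal_mult nn_integral_cmult)
      show "ennreal ((1 - \<delta>) * P x) = (\<integral>\<^sup>+y. riesz_kernel b (x - y) * ennreal ((1 - \<delta>) * \<eta> y) \<partial>lborel)" for x
      proof -
        have "(\<integral>\<^sup>+y. riesz_kernel b (x - y) * ennreal ((1 - \<delta>) * \<eta> y) \<partial>lborel) =
          (\<integral>\<^sup>+y. ennreal (1 - \<delta>) * (riesz_kernel b (x - y) * ennreal (\<eta> y)) \<partial>lborel)"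
          using \<delta> \<eta>0 by (simp add: ennreal_mult mult_ac)
        also have "\<dots> = ennreal (1 - \<delta>) * ennreal (P x)"
          by (subst nn_integral_cmult) (simp_all add: potP)
        finally show ?thesis using \<delta> P0 by (simp add: ennreal_mult)
      qed
      show "(1 - \<delta>) * \<eta> x \<le> A" for x
        using A[of x] \<eta>0[of x] \<delta> mult_right_mono[of "1 - \<delta>" 1 "\<eta> x"] by simp
    qed (use \<delta> \<eta>0 P0 in auto)
  qed
  ultimately show ?thesis
    using \<rho> srm so sup by (intro exI[of _ U] conjI bexI[of _ \<rho>] exI[of _ 2]) auto
qed

theorem theorem1p20:
  fixes b :: real
  assumes "CARD('n::finite) \<ge> 3"
    and "2 - real CARD('n) < b" and "b < 0"
  shows "\<exists>U :: real ^ 'n \<Rightarrow> real.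
           smooth U \<and> radial U \<and> (U \<longlongrightarrow> 0) at_infinity \<and>
           (\<exists>\<rho> \<in> borel_probs. \<exists>R > 0.
              smooth_radial_measure \<rho> \<and> supported_on \<rho> (cball 0 R) \<and>
              (SUP x \<in> ball 0 R. generated_potential (power_potential b) U \<rho> x) < 0) \<and>
           \<not> (\<exists>\<rho>. is_minimizer (power_potential b) U \<rho>)"
  using assms by (intro superharmonic_counterexample) auto

end
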